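(* Let $k$ be a field, let $G$ be a $C_5$-free vertex decomposable graph with vertex set $\{x_1,\dots,x_n\}$, and let $R=k[x_1,\dots,x_n]$. Then $$\mathrm{depth}(R/I(G))=\min\{|F| \mid F\subseteq V(G)\text{ is a maximal independent set in } G\}.$$ Moreover, $R/I(G)$ is Cohen-Macaulay if and only if $G$ is unmixed.
   Context: All graphs are finite and simple. For a graph $G$ with $V(G)=\{x_1,\dots,x_n\}$, the edge ideal is $I(G)=\langle x_ix_j \mid \{x_i,x_j\}\in E(G)\rangle\subseteq R=k[x_1,\dots,x_n]$. For a vertex $v$, $N[v]$ is the set consisting of $v$ and its neighbors. For $S\subseteq V(G)$, $G\setminus S$ is the induced subgraph on $V(G)\setminus S$. An independent set of $G$ is a subset of $V(G)$ containing no edge of $G$; a maximal independent set is one maximal with respect to inclusion. $G$ is $C_5$-free if it contains no cycle of length $5$ as a (not necessarily induced) subgraph. A graph $G$ is (recursively) vertex decomposable if $G$ has no edges, or if (i) there is a vertex $x$ of $G$ such that $G\setminus\{x\}$ and $G\setminus N[x]$ are both vertex decomposable, and (ii) no independent set in $G\setminus N[x]$ is a maximal independent set in $G\setminus\{x\}$. $G$ is unmixed if all maximal independent sets of $G$ have the same cardinality. Depth is taken with respect to the graded maximal ideal $\langle x_1,\dots,x_n\rangle$ of $R$. *)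

theory Defs
  imports
    "HOL-Algebra.QuotRing"
    "HOL-Algebra.Module"
    "HOL-Algebra.Generated_Groups"
    "HOL-Library.Poly_Mapping"
    "HOL-Library.Extended_Nat"
    "Graph_Theory.Digraph_Component"
begin

section \<open>Graphs\<close>

text \<open>
  Finite simple graphs are the finite, loop-free, symmetric digraphs without parallel arcs
  of the locale \<^locale>\<open>graph\<close>: an undirected edge $\{u, v\}$ is the pair of arcs
  $(u, v)$ and $(v, u)$, and adjacency is \<^const>\<open>dominates\<close>.
\<close>

definition closed_neighborhood :: "('v, 'e) pre_digraph \<Rightarrow> 'v \<Rightarrow> 'v set" where
  "closed_neighborhood G v = insert v {u \<in> verts G. v \<rightarrow>\<^bsub>G\<^esub> u}"

definition delete_verts :: "('v, 'e) pre_digraph \<Rightarrow> 'v set \<Rightarrow> ('v, 'e) pre_digraph" where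
  "delete_verts G S = G \<restriction> (verts G - S)"

definition independent_set :: "('v, 'e) pre_digraph \<Rightarrow> 'v set \<Rightarrow> bool" where
  "independent_set G S \<longleftrightarrow> S \<subseteq> verts G \<and> (\<forall>u\<in>S. \<forall>v\<in>S. \<not> u \<rightarrow>\<^bsub>G\<^esub> v)"

definition maximal_independent_set :: "('v, 'e) pre_digraph \<Rightarrow> 'v set \<Rightarrow> bool" where
  "maximal_independent_set G S \<longleftrightarrow>
     independent_set G S \<and> (\<forall>T. independent_set G T \<and> S \<subseteq> T \<longrightarrow> T = S)"

definition unmixed :: "('v, 'e) pre_digraph \<Rightarrow> bool" where
  "unmixed G \<longleftrightarrow>
     (\<forall>S T. maximal_independent_set G S \<and> maximal_independent_set G T \<longrightarrow> card S = card T)"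

text \<open>
  A \<^const>\<open>pre_digraph.cycle\<close> is a closed arc walk without repeated vertices other than its
  end points, so one with five arcs is a (not necessarily induced) $C_5$ in \<open>G\<close>.
\<close>

definition C5_free :: "('v, 'e) pre_digraph \<Rightarrow> bool" where
  "C5_free G \<longleftrightarrow> \<not> (\<exists>p. pre_digraph.cycle G p \<and> length p = 5)"

inductive vertex_decomposable :: "('v, 'e) pre_digraph \<Rightarrow> bool" where
  edgeless: "arcs G = {} \<Longrightarrow> vertex_decomposable G"
| shedding:
    "\<lbrakk> x \<in> verts G;
       vertex_decomposable (delete_verts G {x});
       vertex_decomposable (delete_verts G (closed_neighborhood G x));
       \<forall>S. independent_set (delete_verts G (closed_neighborhood G x)) S \<longrightarrow>
            \<not> maximal_independent_set (delete_verts G {x}) S \<rbrakk>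
     \<Longrightarrow> vertex_decomposable G"


section \<open>Depth and Krull dimension\<close>

text \<open>The submodule $JM$, for a set \<open>J\<close> of scalars.\<close>

definition set_smult :: "'a set \<Rightarrow> ('a, 'm, 'x) module_scheme \<Rightarrow> 'm set" where
  "set_smult J M = generate (add_monoid M) {a \<odot>\<^bsub>M\<^esub> x | a x. a \<in> J \<and> x \<in> carrier M}"

text \<open>
  The condition on \<open>x\<close> says that $f_{i+1}$ is a nonzerodivisor on
  $M/(f_1,\dots,f_i)M$; list positions count from 0.
\<close>

definition regular_sequence ::
  "('a, 'r) ring_scheme \<Rightarrow> ('a, 'm, 'x) module_scheme \<Rightarrow> 'a list \<Rightarrow> bool" where
  "regular_sequence R M fs \<longleftrightarrow>
     set fs \<subseteq> carrier R \<and>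
     (\<forall>i < length fs. \<forall>x \<in> carrier M.
        fs ! i \<odot>\<^bsub>M\<^esub> x \<in> set_smult (genideal R (set (take i fs))) M \<longrightarrow>
        x \<in> set_smult (genideal R (set (take i fs))) M) \<and>
     set_smult (genideal R (set fs)) M \<noteq> carrier M"

text \<open>
  Depth of \<open>M\<close> with respect to the ideal \<open>J\<close>. It has its usual meaning when
  $JM \neq M$; otherwise the value is not the conventional \<open>\<infinity>\<close>.
\<close>

definition depth ::
  "('a, 'r) ring_scheme \<Rightarrow> 'a set \<Rightarrow> ('a, 'm, 'x) module_scheme \<Rightarrow> enat" where
  "depth R J M = Sup {enat (length fs) | fs. set fs \<subseteq> J \<and> regular_sequence R M fs}"

text \<open>The zero ring has no primes and gets dimension 0.\<close>

definition krull_dim :: "('a, 'r) ring_scheme \<Rightarrow> enat" where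
  "krull_dim A = Sup {enat d | d. \<exists>P :: nat \<Rightarrow> 'a set.
     (\<forall>i \<le> d. primeideal (P i) A) \<and> (\<forall>i < d. P i \<subset> P (Suc i))}"

definition annihilator ::
  "('a, 'r) ring_scheme \<Rightarrow> ('a, 'm, 'x) module_scheme \<Rightarrow> 'a set" where
  "annihilator R M = {r \<in> carrier R. \<forall>x \<in> carrier M. r \<odot>\<^bsub>M\<^esub> x = \<zero>\<^bsub>M\<^esub>}"

definition module_dim ::
  "('a, 'r) ring_scheme \<Rightarrow> ('a, 'm, 'x) module_scheme \<Rightarrow> enat" where
  "module_dim R M = krull_dim (R Quot annihilator R M)"

text \<open>
  The Cohen-Macaulay property as it is defined for a nonzero finitely generated (graded)
  module over a Noetherian local ring, or over a standard graded algebra over a field,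
  with (graded) maximal ideal \<open>m\<close>.
\<close>

definition cohen_macaulay ::
  "('a, 'r) ring_scheme \<Rightarrow> 'a set \<Rightarrow> ('a, 'm, 'x) module_scheme \<Rightarrow> bool" where
  "cohen_macaulay R m M \<longleftrightarrow> depth R m M = module_dim R M"

text \<open>The quotient ring $R/I$ as an \<open>R\<close>-module.\<close>

definition quotient_module ::
  "('a, 'r) ring_scheme \<Rightarrow> 'a set \<Rightarrow> ('a, 'a set) module" where
  "quotient_module R I =
     ring.extend (R Quot I)
       (module.fields (\<lambda>r X. (I +>\<^bsub>R\<^esub> r) \<otimes>\<^bsub>R Quot I\<^esub> X))"


section \<open>Edge ideals\<close>

text \<open>
  Monomials are finitely supported exponent functions, and polynomials are finitely
  supported coefficient functions on monomials. The polynomial ring in the variables \<open>V\<close>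
  consists of the polynomials in whose monomials only variables from \<open>V\<close> occur.
\<close>

type_synonym ('v, 'k) mpoly = "('v \<Rightarrow>\<^sub>0 nat) \<Rightarrow>\<^sub>0 'k"

definition polynomial_ring :: "'k::field itself \<Rightarrow> 'v set \<Rightarrow> ('v, 'k) mpoly ring" where
  "polynomial_ring k V =
     \<lparr> carrier = {p. \<forall>m \<in> Poly_Mapping.keys p. Poly_Mapping.keys m \<subseteq> V},
       monoid.mult = (*), one = 1, zero = 0, add = (+) \<rparr>"

definition pvar :: "'k::field itself \<Rightarrow> 'v \<Rightarrow> ('v, 'k) mpoly" where
  "pvar k v = Poly_Mapping.single (Poly_Mapping.single v 1) 1"

definition graded_maximal_ideal :: "'k::field itself \<Rightarrow> 'v set \<Rightarrow> ('v, 'k) mpoly set" where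
  "graded_maximal_ideal k V = genideal (polynomial_ring k V) (pvar k ` V)"

definition edge_ideal :: "'k::field itself \<Rightarrow> ('v, 'e) pre_digraph \<Rightarrow> ('v, 'k) mpoly set" where
  "edge_ideal k G =
     genideal (polynomial_ring k (verts G)) {pvar k u * pvar k v | u v. u \<rightarrow>\<^bsub>G\<^esub> v}"

definition edge_quotient ::
  "'k::field itself \<Rightarrow> ('v, 'e) pre_digraph \<Rightarrow> (('v, 'k) mpoly, ('v, 'k) mpoly set) module" where
  "edge_quotient k G = quotient_module (polynomial_ring k (verts G)) (edge_ideal k G)"

end

theory Submission
  imports Defs
begin

text \<open>
  Everything takes place in the full polynomial ring on the type of vertices, modulo the ideal
  spanned by the monomials whose support is not independent. Write $e_i$ for the elementary
  symmetric polynomial in all vertices and $x^F$ for the product of the variables in $F$.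

  Lower bound for the depth: weak regularity of a fixed sequence modulo $J$ follows from weak
  regularity modulo $J : x$ and $J + xR$. For a shedding vertex $x$ these two ideals belong to
  $G \setminus N[x]$, with $x$ as a free variable, and to $G \setminus \{x\}$, so induction reduces the
  claim to polynomial rings $k[F]$, in which $e_1, \dots, e_t$ is regular for $t \le |F|$.

  Upper bound: for a facet $F$ the annihilator of $x^F$ is the prime with quotient $k[F]$.
  If a regular sequence had more than $|F|$ members, then their $N$-th powers, which are again
  regular, would satisfy a polynomial relation modulo this prime. Cancelling lowest
  terms along the sequence forces $x^F$ into the ideal of these powers, which is
  impossible by degree. The same cancellation along a chain of primes bounds the Krull dimension.
\<close>

section \<open>Regular sequences\<close>

text \<open>The outer terms of a short exact sequence need not share a regular sequence, which is
  why the depth lemma is normally proved through Ext or local cohomology. Fixing one sequence in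
  advance avoids this, at the price that it must serve every graph met in the induction; hence the
  $e_i$ are formed in all vertices of the original graph and never change. Modulo the variables
  outside a set they become the elementary symmetric polynomials of that set. Likewise a deleted
  vertex is not removed from the ring: its variable enters the ideal, so all ideals of the induction
  live in one ring. The upper bound cannot play $x^F$ against the sequence itself: for a simplex
  with vertex set $F$ the last $e_i$ equals $x^F$. Powers with exponent above $|F|$ exclude this by
  degree. Counting monomials takes the place of transcendence degree; it yields a relation with unit
  coefficients, and the same argument then serves depth and dimension.\<close>

definition ring_ideal :: "'a::comm_ring_1 set \<Rightarrow> bool" where
  "ring_ideal J \<longleftrightarrow> 0 \<in> J \<and> (\<forall>a\<in>J. \<forall>b\<in>J. a + b \<in> J) \<and> (\<forall>a\<in>J. \<forall>r. r * a \<in> J)"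

text \<open>For an ideal \<open>J\<close>, \<open>foldl adjoin J fs\<close> is the ideal generated
  by \<open>J\<close> and \<open>fs\<close>. Adding one generator at a time matches the recursion of
  \<open>weakly_regular\<close>, and \<open>adjoin_commute\<close> exchanges neighbours.\<close>

definition adjoin :: "'a::comm_ring_1 set \<Rightarrow> 'a \<Rightarrow> 'a set" where
  "adjoin J f = {j + f * r | j r. j \<in> J}"

definition colon :: "'a::comm_ring_1 set \<Rightarrow> 'a \<Rightarrow> 'a set" where
  "colon J x = {y. x * y \<in> J}"

definition nonzerodivisor_mod :: "'a::comm_ring_1 set \<Rightarrow> 'a \<Rightarrow> bool" where
  "nonzerodivisor_mod J f \<longleftrightarrow> (\<forall>y. f * y \<in> J \<longrightarrow> y \<in> J)"

text \<open>Properness is left out on purpose: the unit ideal then admits every sequence, which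
  starts the induction on exponents in \<open>weakly_regular_adjoin_power\<close>, and no properness
  has to be tracked through colons. It returns in \<open>regular_sequence_iff\<close>.\<close>

fun weakly_regular :: "'a::comm_ring_1 set \<Rightarrow> 'a list \<Rightarrow> bool" where
  "weakly_regular J [] \<longleftrightarrow> True"
| "weakly_regular J (f # fs) \<longleftrightarrow> nonzerodivisor_mod J f \<and> weakly_regular (adjoin J f) fs"

lemma ring_idealI:
  assumes "0 \<in> J" "\<And>a b. a \<in> J \<Longrightarrow> b \<in> J \<Longrightarrow> a + b \<in> J" "\<And>a r. a \<in> J \<Longrightarrow> r * a \<in> J"
  shows "ring_ideal J"
  using assms by (auto simp: ring_ideal_def)

lemma
  assumes "ring_ideal J"
  shows ring_ideal_zero: "0 \<in> J"
    and ring_ideal_add: "a \<in> J \<Longrightarrow> b \<in> J \<Longrightarrow> a + b \<in> J"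
    and ring_ideal_mult: "a \<in> J \<Longrightarrow> r * a \<in> J"
    and ring_ideal_mult_right: "a \<in> J \<Longrightarrow> a * r \<in> J"
    and ring_ideal_diff: "a \<in> J \<Longrightarrow> b \<in> J \<Longrightarrow> a - b \<in> J"
proof -
  show "0 \<in> J"
    using assms by (auto simp: ring_ideal_def)
  show add: "a \<in> J \<Longrightarrow> b \<in> J \<Longrightarrow> a + b \<in> J" for a b
    using assms by (auto simp: ring_ideal_def)
  show mult: "a \<in> J \<Longrightarrow> r * a \<in> J" for a r
    using assms by (auto simp: ring_ideal_def)
  show "a \<in> J \<Longrightarrow> a * r \<in> J"
    using mult[of a r] by (simp add: mult.commute)
  show "a \<in> J \<Longrightarrow> b \<in> J \<Longrightarrow> a - b \<in> J"
    using add[of a "-1 * b"] mult[of b "-1"] by simp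
qed

lemma ring_ideal_sum:
  assumes "ring_ideal J" "\<And>i. i \<in> A \<Longrightarrow> f i \<in> J"
  shows "sum f A \<in> J"
  using assms(2)
  by (induction A rule: infinite_finite_induct)
    (auto intro: ring_ideal_zero[OF assms(1)] ring_ideal_add[OF assms(1)])

lemma ring_ideal_add_iff:
  assumes "ring_ideal J" "b \<in> J"
  shows "a + b \<in> J \<longleftrightarrow> a \<in> J"
  using ring_ideal_add[OF assms(1), of a b] ring_ideal_diff[OF assms(1), of "a + b" b] assms(2)
  by auto

lemma adjoin_iff: "p \<in> adjoin J f \<longleftrightarrow> (\<exists>r. p - f * r \<in> J)"
proof
  assume "\<exists>r. p - f * r \<in> J"
  then obtain r where "p - f * r \<in> J" by blast
  then show "p \<in> adjoin J f"
    unfolding adjoin_def mem_Collect_eq by (intro exI[of _ "p - f * r"] exI[of _ r]) simp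
next
  assume "p \<in> adjoin J f"
  then obtain j r where "j \<in> J" "p = j + f * r" unfolding adjoin_def by blast
  then show "\<exists>r. p - f * r \<in> J" by (intro exI[of _ r]) simp
qed

lemma ring_ideal_adjoin:
  assumes "ring_ideal J"
  shows "ring_ideal (adjoin J f)"
proof (rule ring_idealI)
  show "0 \<in> adjoin J f"
    unfolding adjoin_iff using ring_ideal_zero[OF assms] by (intro exI[of _ 0]) simp
next
  fix a b assume "a \<in> adjoin J f" "b \<in> adjoin J f"
  then obtain r s where "a - f * r \<in> J" "b - f * s \<in> J" unfolding adjoin_iff by blast
  then have "(a - f * r) + (b - f * s) \<in> J" by (rule ring_ideal_add[OF assms])
  then show "a + b \<in> adjoin J f"
    unfolding adjoin_iff by (intro exI[of _ "r + s"]) (simp add: algebra_simps)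
next
  fix a c assume "a \<in> adjoin J f"
  then obtain r where "a - f * r \<in> J" unfolding adjoin_iff by blast
  then have "c * (a - f * r) \<in> J" by (rule ring_ideal_mult[OF assms])
  then show "c * a \<in> adjoin J f"
    unfolding adjoin_iff by (intro exI[of _ "c * r"]) (simp add: algebra_simps)
qed

lemma adjoin_base: "j \<in> J \<Longrightarrow> j \<in> adjoin J f"
  unfolding adjoin_iff by (intro exI[of _ 0]) simp

lemma adjoin_gen: "ring_ideal J \<Longrightarrow> f * r \<in> adjoin J f"
  unfolding adjoin_iff by (intro exI[of _ r]) (simp add: ring_ideal_zero)

lemma adjoin_least:
  assumes "ring_ideal K" "J \<subseteq> K" "f \<in> K"
  shows "adjoin J f \<subseteq> K"
  unfolding adjoin_def
  using assms ring_ideal_add[OF assms(1)] ring_ideal_mult_right[OF assms(1)] by blast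

lemma adjoin_commute: "adjoin (adjoin J f) g = adjoin (adjoin J g) f"
  unfolding set_eq_iff adjoin_iff cancel_ab_semigroup_add_class.diff_right_commute[of _ "g * _"
      "f * _"] by blast

lemma ring_ideal_foldl_adjoin: "ring_ideal J \<Longrightarrow> ring_ideal (foldl adjoin J fs)"
  by (induction fs arbitrary: J) (auto intro: ring_ideal_adjoin)

lemma foldl_adjoin_base: "j \<in> J \<Longrightarrow> j \<in> foldl adjoin J fs"
  by (induction fs arbitrary: J) (auto intro: adjoin_base)

lemma foldl_adjoin_gen:
  assumes "ring_ideal J" "f \<in> set fs"
  shows "f \<in> foldl adjoin J fs"
  using assms
proof (induction fs arbitrary: J)
  case (Cons g gs)
  show ?case
  proof (cases "f = g")
    case True
    then have "f \<in> adjoin J g" using adjoin_gen[OF Cons.prems(1), of g 1] by simp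
    then show ?thesis by (auto intro: foldl_adjoin_base)
  qed (use Cons ring_ideal_adjoin in auto)
qed simp

lemma foldl_adjoin_least:
  assumes "ring_ideal K" "J \<subseteq> K" "set fs \<subseteq> K"
  shows "foldl adjoin J fs \<subseteq> K"
  using assms(2,3)
proof (induction fs arbitrary: J)
  case (Cons g gs)
  then show ?case using adjoin_least[OF assms(1)] by simp
qed simp

lemma weakly_regular_append:
  "weakly_regular J (fs @ gs) \<longleftrightarrow>
     weakly_regular J fs \<and> weakly_regular (foldl adjoin J fs) gs"
  by (induction fs arbitrary: J) auto

lemma weakly_regular_iff_nth:
  "weakly_regular J fs \<longleftrightarrow>
     (\<forall>i<length fs. nonzerodivisor_mod (foldl adjoin J (take i fs)) (fs ! i))"
  by (induction fs arbitrary: J) (auto simp: less_Suc_eq_0_disj)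

lemma weakly_regular_UNIV: "weakly_regular UNIV fs"
proof (induction fs)
  case (Cons f fs)
  have "adjoin UNIV f = UNIV" unfolding adjoin_iff set_eq_iff by auto
  with Cons show ?case by (simp add: nonzerodivisor_mod_def)
qed simp

text \<open>
  This is the depth lemma for $0 \to R/(J : x) \to R/J \to R/(J + xR) \to 0$, for a fixed sequence.
\<close>

lemma weakly_regular_colon:
  assumes "ring_ideal J" "weakly_regular (colon J x) fs" "weakly_regular (adjoin J x) fs"
  shows "weakly_regular J fs"
  using assms
proof (induction fs arbitrary: J)
  case (Cons f fs)
  note J = Cons.prems(1)
  have nzd: "nonzerodivisor_mod (colon J x) f" "nonzerodivisor_mod (adjoin J x) f"
    using Cons.prems by auto
  \<comment> \<open>The tail is treated over \<open>adjoin J f\<close>, so taking the colon by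
    \<open>x\<close> must commute with adjoining \<open>f\<close>. The inclusion from left to right
    needs \<open>f\<close> to be a nonzerodivisor modulo \<open>adjoin J x\<close>.\<close>
  have colon: "colon (adjoin J f) x = adjoin (colon J x) f"
  proof (intro Set.set_eqI iffI)
    fix z assume "z \<in> colon (adjoin J f) x"
    then obtain y where y: "x * z - f * y \<in> J" unfolding colon_def adjoin_iff by blast
    then have "x * z - (x * z - f * y) \<in> adjoin J x"
      by (intro ring_ideal_diff[OF ring_ideal_adjoin[OF J]] adjoin_gen[OF J] adjoin_base)
    then have "y \<in> adjoin J x" using nzd(2) by (simp add: nonzerodivisor_mod_def)
    then obtain w where w: "y - x * w \<in> J" unfolding adjoin_iff by blast
    have "(x * z - f * y) + f * (y - x * w) \<in> J"
      using y w by (intro ring_ideal_add[OF J] ring_ideal_mult[OF J])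
    then have "x * (z - f * w) \<in> J" by (simp add: algebra_simps)
    then show "z \<in> adjoin (colon J x) f" unfolding colon_def adjoin_iff by blast
  next
    fix z assume "z \<in> adjoin (colon J x) f"
    then obtain w where "x * (z - f * w) \<in> J" unfolding colon_def adjoin_iff by blast
    then show "z \<in> colon (adjoin J f) x"
      unfolding colon_def mem_Collect_eq adjoin_iff
      by (intro exI[of _ "x * w"]) (simp add: algebra_simps)
  qed
  have "nonzerodivisor_mod J f"
    unfolding nonzerodivisor_mod_def
  proof (intro allI impI)
    fix y assume y: "f * y \<in> J"
    then have "y \<in> adjoin J x"
      using nzd(2) adjoin_base by (auto simp: nonzerodivisor_mod_def)
    then obtain z where z: "y - x * z \<in> J" unfolding adjoin_iff by blast
    have "f * y - f * (y - x * z) \<in> J"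
      using y z by (simp add: ring_ideal_diff[OF J] ring_ideal_mult[OF J])
    then have "f * z \<in> colon J x" by (simp add: colon_def algebra_simps)
    then have "z \<in> colon J x" using nzd(1) by (simp add: nonzerodivisor_mod_def)
    then have "(y - x * z) + x * z \<in> J"
      using z by (intro ring_ideal_add[OF J]) (simp_all add: colon_def)
    then show "y \<in> J" by simp
  qed
  moreover have "weakly_regular (adjoin J f) fs"
    using Cons.prems Cons.IH[OF ring_ideal_adjoin[OF J, of f]]
    by (simp add: colon adjoin_commute[of J f x])
  ultimately show ?case by simp
qed simp

section \<open>Nonzerodivisors and powers of regular sequences\<close>

lemma nonzerodivisor_mod_one: "nonzerodivisor_mod J 1"
  by (simp add: nonzerodivisor_mod_def)

lemma nonzerodivisor_mod_mult:
  "nonzerodivisor_mod J f \<Longrightarrow> nonzerodivisor_mod J g \<Longrightarrow> nonzerodivisor_mod J (f * g)"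
  unfolding nonzerodivisor_mod_def mult.assoc by blast

lemma nonzerodivisor_mod_power:
  "nonzerodivisor_mod J f \<Longrightarrow> nonzerodivisor_mod J (f ^ n)"
  by (induction n) (simp_all add: nonzerodivisor_mod_mult nonzerodivisor_mod_one)

lemma nonzerodivisor_mod_prod:
  "(\<And>i. i \<in> A \<Longrightarrow> nonzerodivisor_mod J (f i)) \<Longrightarrow> nonzerodivisor_mod J (prod f A)"
  by (induction A rule: infinite_finite_induct)
    (simp_all add: nonzerodivisor_mod_mult nonzerodivisor_mod_one)

lemma nonzerodivisor_mod_cong:
  assumes "ring_ideal J" "f - g \<in> J" "nonzerodivisor_mod J g"
  shows "nonzerodivisor_mod J f"
  unfolding nonzerodivisor_mod_def
proof (intro allI impI)
  fix y assume "f * y \<in> J"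
  then have "f * y - y * (f - g) \<in> J"
    using assms(1,2) by (simp add: ring_ideal_diff ring_ideal_mult)
  then show "y \<in> J" using assms(3) by (simp add: nonzerodivisor_mod_def algebra_simps)
qed

text \<open>Induction on the exponent through \<open>weakly_regular_colon\<close>: the ideal with
  \<open>f ^ Suc n\<close> adjoined has as colon by \<open>f\<close> the ideal with
  \<open>f ^ n\<close> adjoined, and adding \<open>f\<close> to it gives back
  \<open>adjoin J f\<close>. Exponent 0 is the unit ideal.\<close>

lemma weakly_regular_adjoin_power:
  assumes J: "ring_ideal J" and nzd: "nonzerodivisor_mod J f" and reg: "weakly_regular (adjoin J f) fs"
  shows "weakly_regular (adjoin J (f ^ n)) fs"
proof (induction n)
  case 0
  have "adjoin J 1 = UNIV"
    using adjoin_gen[OF J, of 1] by auto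
  then show ?case by (simp add: weakly_regular_UNIV)
next
  case (Suc n)
  have "colon (adjoin J (f ^ Suc n)) f = adjoin J (f ^ n)"
  proof (intro Set.set_eqI iffI)
    fix y assume "y \<in> colon (adjoin J (f ^ Suc n)) f"
    then obtain r where "f * y - f ^ Suc n * r \<in> J" unfolding colon_def adjoin_iff by blast
    then have "f * (y - f ^ n * r) \<in> J" by (simp add: algebra_simps)
    then show "y \<in> adjoin J (f ^ n)"
      using nzd unfolding nonzerodivisor_mod_def adjoin_iff by blast
  next
    fix y assume "y \<in> adjoin J (f ^ n)"
    then obtain r where "y - f ^ n * r \<in> J" unfolding adjoin_iff by blast
    from ring_ideal_mult[OF J this, of f]
    have "f * y - f ^ Suc n * r \<in> J" by (simp add: algebra_simps)
    then show "y \<in> colon (adjoin J (f ^ Suc n)) f" unfolding colon_def adjoin_iff by blast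
  qed
  moreover have "adjoin (adjoin J (f ^ Suc n)) f = adjoin J f"
  proof (rule subset_antisym)
    have "f \<in> adjoin J f" using adjoin_gen[OF J, of f 1] by simp
    then show "adjoin (adjoin J (f ^ Suc n)) f \<subseteq> adjoin J f"
      using adjoin_gen[OF J, of f "f ^ n"]
      by (intro adjoin_least ring_ideal_adjoin[OF J]) (auto intro: adjoin_base)
    have "f \<in> adjoin (adjoin J (f ^ Suc n)) f"
      using adjoin_gen[OF ring_ideal_adjoin[OF J], of f 1] by simp
    then show "adjoin J f \<subseteq> adjoin (adjoin J (f ^ Suc n)) f"
      by (intro adjoin_least ring_ideal_adjoin J) (auto intro: adjoin_base)
  qed
  ultimately show ?case
    using weakly_regular_colon[OF ring_ideal_adjoin[OF J, of "f ^ Suc n"], of f fs] Suc reg by simp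
qed

text \<open>The order matters: the tail is raised to powers while the head is still
  \<open>f\<close>, and only then is \<open>f\<close> replaced by its power beneath the new
  tail.\<close>

lemma weakly_regular_powers:
  assumes "ring_ideal J" "weakly_regular J fs"
  shows "weakly_regular J (map (\<lambda>f. f ^ n) fs)"
  using assms
proof (induction fs arbitrary: J)
  case (Cons f fs)
  have "weakly_regular (adjoin J f) (map (\<lambda>f. f ^ n) fs)"
    using Cons.prems by (intro Cons.IH ring_ideal_adjoin) simp_all
  then show ?case
    using Cons.prems by (simp add: nonzerodivisor_mod_power weakly_regular_adjoin_power)
qed simp

section \<open>Chains of ideals and polynomial relations\<close>

fun power_product :: "'a::comm_monoid_mult list \<Rightarrow> nat list \<Rightarrow> 'a" where
  "power_product (g # gs) (a # as) = g ^ a * power_product gs as"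
| "power_product _ _ = 1"

text \<open>Common form of two situations. For a weakly regular sequence the next ideal
  \<open>K'\<close> is \<open>adjoin K g\<close> itself; for a chain of primes \<open>K'\<close> is
  the next prime and \<open>g\<close> any element of it outside \<open>K\<close>. Asking only for an
  inclusion covers both.\<close>

inductive ideal_chain :: "'a::comm_ring_1 set \<Rightarrow> 'a list \<Rightarrow> 'a set \<Rightarrow> bool" where
  Nil: "ring_ideal K \<Longrightarrow> ideal_chain K [] K"
| Cons: "ring_ideal K \<Longrightarrow> nonzerodivisor_mod K g \<Longrightarrow> adjoin K g \<subseteq> K' \<Longrightarrow>
     ideal_chain K' gs L \<Longrightarrow> ideal_chain K (g # gs) L"

lemma ideal_chain_weakly_regular:
  "ring_ideal J \<Longrightarrow> weakly_regular J fs \<Longrightarrow> ideal_chain J fs (foldl adjoin J fs)"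
  by (induction fs arbitrary: J) (auto intro: ideal_chain.intros ring_ideal_adjoin)

text \<open>
  The terms of lowest degree in the first member of \<open>gs\<close> survive modulo the next ideal of the
  chain, after that member has been cancelled; this is iterated along \<open>gs\<close>.
\<close>

lemma ideal_chain_polynomial_relation:
  assumes "ideal_chain K gs L" "finite A" "A \<noteq> {}"
    and "\<And>\<alpha>. \<alpha> \<in> A \<Longrightarrow> length \<alpha> = length gs" "\<And>\<alpha>. \<alpha> \<in> A \<Longrightarrow> \<phi> \<alpha> dvd 1"
    and "(\<Sum>\<alpha>\<in>A. \<phi> \<alpha> * power_product gs \<alpha>) * z \<in> K"
  shows "z \<in> L"
  using assms
proof (induction K gs L arbitrary: A \<phi> z rule: ideal_chain.induct)
  case (Nil K)
  then have "A = {[]}" by fastforce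
  then have "\<phi> [] * z \<in> K" "\<phi> [] dvd 1" using Nil by auto
  then obtain u where "\<phi> [] * z \<in> K" "1 = \<phi> [] * u" by auto
  with ring_ideal_mult[OF \<open>ring_ideal K\<close>, of "\<phi> [] * z" u] show ?case
    by (metis mult.assoc mult.commute mult_1)
next
  case (Cons K g K' gs L)
  define a where "a = Min (hd ` A)"
  have a_le: "a \<le> hd \<alpha>" if "\<alpha> \<in> A" for \<alpha>
    using that Cons.prems(1) by (simp add: a_def)
  have "a \<in> hd ` A" unfolding a_def using Cons.prems by (intro Min_in) auto
  define A0 where "A0 = {\<alpha> \<in> A. hd \<alpha> = a}"
  have form: "\<alpha> = hd \<alpha> # tl \<alpha>" if "\<alpha> \<in> A" for \<alpha>
    using Cons.prems(3)[OF that] by (cases \<alpha>) auto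
  define h where "h \<alpha> = \<phi> \<alpha> * g ^ (hd \<alpha> - a) * power_product gs (tl \<alpha>)" for \<alpha>
  have "\<phi> \<alpha> * power_product (g # gs) \<alpha> = g ^ a * h \<alpha>" if "\<alpha> \<in> A" for \<alpha>
  proof -
    have "\<phi> \<alpha> * power_product (g # gs) \<alpha> = \<phi> \<alpha> * (g ^ (a + (hd \<alpha> - a)) * power_product gs (tl \<alpha>))"
      using a_le[OF that] by (subst form[OF that]) simp
    then show ?thesis by (simp add: h_def power_add mult_ac)
  qed
  then have "g ^ a * ((\<Sum>\<alpha>\<in>A. h \<alpha>) * z) \<in> K"
    using Cons.prems(5) by (simp add: sum_distrib_left mult.assoc[symmetric])
  then have hK: "(\<Sum>\<alpha>\<in>A. h \<alpha>) * z \<in> K"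
    using nonzerodivisor_mod_power[OF Cons.hyps(2), of a] by (simp add: nonzerodivisor_mod_def)
  have "ring_ideal K'" using Cons.hyps(4) by (cases rule: ideal_chain.cases) auto
  have "\<exists>r. h \<alpha> * z = g * r" if "\<alpha> \<in> A - A0" for \<alpha>
  proof -
    have "hd \<alpha> - a = Suc (hd \<alpha> - a - 1)" using a_le[of \<alpha>] that by (auto simp: A0_def)
    then have "h \<alpha> * z = g * (\<phi> \<alpha> * g ^ (hd \<alpha> - a - 1) * power_product gs (tl \<alpha>) * z)"
      unfolding h_def by (metis (no_types, lifting) mult.assoc mult.left_commute power_Suc)
    then show ?thesis by blast
  qed
  then have rest: "(\<Sum>\<alpha>\<in>A - A0. h \<alpha>) * z \<in> K'"
    unfolding sum_distrib_right
    using adjoin_gen[OF Cons.hyps(1)] Cons.hyps(3)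
    by (intro ring_ideal_sum \<open>ring_ideal K'\<close>) fastforce
  have "(\<Sum>\<alpha>\<in>A. h \<alpha>) = (\<Sum>\<alpha>\<in>A - A0. h \<alpha>) + (\<Sum>\<alpha>\<in>A0. h \<alpha>)"
    using Cons.prems(1) by (intro sum.subset_diff) (auto simp: A0_def)
  moreover have "(\<Sum>\<alpha>\<in>A. h \<alpha>) * z \<in> K'"
    using hK Cons.hyps(3) adjoin_base[of _ K g] by blast
  ultimately have "(\<Sum>\<alpha>\<in>A0. h \<alpha>) * z \<in> K'"
    using ring_ideal_diff[OF \<open>ring_ideal K'\<close> _ rest, of "(\<Sum>\<alpha>\<in>A. h \<alpha>) * z"]
    by (simp add: distrib_right)
  \<comment> \<open>On \<open>A0\<close> the first exponent is the constant \<open>a\<close>, so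
    \<open>tl\<close> is injective there and the surviving terms can be reindexed by their tails,
    with coefficients \<phi> (a # \<beta>).\<close>
  moreover have "(\<Sum>\<beta>\<in>tl ` A0. \<phi> (a # \<beta>) * power_product gs \<beta>) = (\<Sum>\<alpha>\<in>A0. h \<alpha>)"
  proof (subst sum.reindex)
    show "inj_on tl A0"
      by (rule inj_onI) (metis (mono_tags, lifting) A0_def form mem_Collect_eq)
    show "sum ((\<lambda>\<beta>. \<phi> (a # \<beta>) * power_product gs \<beta>) \<circ> tl) A0 = (\<Sum>\<alpha>\<in>A0. h \<alpha>)"
      by (rule sum.cong) (use form in \<open>auto simp: A0_def h_def\<close>)
  qed
  ultimately have "(\<Sum>\<beta>\<in>tl ` A0. \<phi> (a # \<beta>) * power_product gs \<beta>) * z \<in> K'" by simp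
  moreover have "\<phi> (a # \<beta>) dvd 1" if "\<beta> \<in> tl ` A0" for \<beta>
    using that Cons.prems(4) form by (auto simp: A0_def)
  moreover have "length \<beta> = length gs" if "\<beta> \<in> tl ` A0" for \<beta>
    using that Cons.prems(3) by (auto simp: A0_def)
  moreover have "finite (tl ` A0)" "tl ` A0 \<noteq> {}"
    using \<open>a \<in> hd ` A\<close> Cons.prems(1) by (auto simp: A0_def)
  ultimately show ?case by (intro Cons.IH[of "tl ` A0"])
qed

section \<open>Face ideals and elementary symmetric polynomials\<close>

text \<open>One operator with three uses: homogeneous components, separating the terms divisible by
  a variable, and projection onto the polynomials in given variables.\<close>

lift_definition restrict_keys :: "('a \<Rightarrow> bool) \<Rightarrow> ('a \<Rightarrow>\<^sub>0 'b::zero) \<Rightarrow> 'a \<Rightarrow>\<^sub>0 'b" is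
  "\<lambda>P f m. if P m then f m else 0"
  by (erule finite_subset[rotated]) (auto split: if_splits)

lemma lookup_restrict_keys:
  "Poly_Mapping.lookup (restrict_keys P p) m = (if P m then Poly_Mapping.lookup p m else 0)"
  by transfer simp

lemma keys_restrict_keys: "Poly_Mapping.keys (restrict_keys P p) = {m \<in> Poly_Mapping.keys p. P m}"
  by (auto simp: in_keys_iff lookup_restrict_keys split: if_splits)

lemma restrict_keys_add:
  "restrict_keys P (p + q) = restrict_keys P p + restrict_keys P (q :: 'a \<Rightarrow>\<^sub>0 'b::monoid_add)"
  by (rule poly_mapping_eqI) (simp add: lookup_restrict_keys lookup_add)

lemma restrict_keys_diff:
  "restrict_keys P (p - q) = restrict_keys P p - restrict_keys P (q :: 'a \<Rightarrow>\<^sub>0 'b::ab_group_add)"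
  by (rule poly_mapping_eqI) (simp add: lookup_restrict_keys lookup_minus)

lemma restrict_keys_id:
  assumes "\<And>m. m \<in> Poly_Mapping.keys p \<Longrightarrow> P m"
  shows "restrict_keys P p = p"
  by (rule poly_mapping_eqI) (use assms in \<open>auto simp: lookup_restrict_keys in_keys_iff\<close>)

lemma restrict_keys_eq_0:
  assumes "\<And>m. m \<in> Poly_Mapping.keys p \<Longrightarrow> \<not> P m"
  shows "restrict_keys P p = 0"
  by (rule poly_mapping_eqI) (use assms in \<open>auto simp: lookup_restrict_keys in_keys_iff\<close>)

lemma restrict_keys_split:
  "p = restrict_keys P p + restrict_keys (\<lambda>m. \<not> P m) (p :: 'a \<Rightarrow>\<^sub>0 'b::monoid_add)"
  by (rule poly_mapping_eqI) (simp add: lookup_restrict_keys lookup_add)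

lemma poly_mapping_sum_single:
  "p = (\<Sum>m\<in>Poly_Mapping.keys p. Poly_Mapping.single m (Poly_Mapping.lookup p m))"
proof (rule poly_mapping_eqI)
  fix k
  have "(\<Sum>m\<in>Poly_Mapping.keys p. Poly_Mapping.lookup (Poly_Mapping.single m (Poly_Mapping.lookup p m)) k) =
    (\<Sum>m\<in>Poly_Mapping.keys p. if k = m then Poly_Mapping.lookup p m else 0)"
    by (intro sum.cong) (auto simp: lookup_single)
  also have "\<dots> = Poly_Mapping.lookup p k" by (simp add: in_keys_iff)
  finally show "Poly_Mapping.lookup p k =
    Poly_Mapping.lookup (\<Sum>m\<in>Poly_Mapping.keys p. Poly_Mapping.single m (Poly_Mapping.lookup p m)) k"
    by (simp add: lookup_sum)
qed

text \<open>By cancellation \<open>a + m\<close> has only one factorisation with first factor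
  \<open>a\<close>, so the convolution collapses to one term.\<close>

lemma lookup_single_mult:
  fixes p :: "'a::cancel_comm_monoid_add \<Rightarrow>\<^sub>0 'b::comm_semiring_1"
  shows "Poly_Mapping.lookup (Poly_Mapping.single a c * p) (a + m) = c * Poly_Mapping.lookup p m"
proof -
  have "Poly_Mapping.lookup (Poly_Mapping.single a c * p) (a + m) =
    (\<Sum>l. (c * (\<Sum>q. Poly_Mapping.lookup p q when a + m = l + q) when l = a))"
    unfolding lookup_mult lookup_single
    by (rule arg_cong[where f = Sum_any]) (auto simp: fun_eq_iff when_def)
  then show ?thesis by simp
qed

lemma keys_single_one_mult:
  fixes p :: "'a::cancel_comm_monoid_add \<Rightarrow>\<^sub>0 'b::comm_semiring_1"
  shows "Poly_Mapping.keys (Poly_Mapping.single a 1 * p) = (+) a ` Poly_Mapping.keys p"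
proof
  show "Poly_Mapping.keys (Poly_Mapping.single a 1 * p) \<subseteq> (+) a ` Poly_Mapping.keys p"
    using keys_mult[of "Poly_Mapping.single a 1" p] by auto
  show "(+) a ` Poly_Mapping.keys p \<subseteq> Poly_Mapping.keys (Poly_Mapping.single a 1 * p)"
    by (auto simp: in_keys_iff lookup_single_mult)
qed

lemma keys_plus_nat: "Poly_Mapping.keys (m + n :: 'a \<Rightarrow>\<^sub>0 nat) =
    Poly_Mapping.keys m \<union> Poly_Mapping.keys n"
  by (auto simp: in_keys_iff lookup_add)

section \<open>Stanley-Reisner ideals\<close>

abbreviation var :: "'v \<Rightarrow> ('v, 'k::field) mpoly" where
  "var v \<equiv> Poly_Mapping.single (Poly_Mapping.single v 1) 1"

text \<open>The Stanley-Reisner ideal, taken in all variables of the type: a variable whose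
  singleton is not a face lies in it. Thus \<open>face_ideal (Pow F)\<close> is the prime generated
  by the variables outside \<open>F\<close>, and \<open>face_ideal {{}}\<close> consists of the
  polynomials without constant term.\<close>

definition face_ideal :: "'v set set \<Rightarrow> ('v, 'k::field) mpoly set" where
  "face_ideal C = {p. \<forall>m\<in>Poly_Mapping.keys p. Poly_Mapping.keys m \<notin> C}"

definition simplicial_complex :: "'v set set \<Rightarrow> bool" where
  "simplicial_complex C \<longleftrightarrow> (\<forall>S\<in>C. \<forall>T\<subseteq>S. T \<in> C)"

lemma ring_ideal_face_ideal:
  assumes "simplicial_complex C"
  shows "ring_ideal (face_ideal C)"
proof (rule ring_idealI)
  fix a b :: "('a, 'b) mpoly" assume "a \<in> face_ideal C" "b \<in> face_ideal C"
  then show "a + b \<in> face_ideal C" unfolding face_ideal_def using keys_add[of a b] by blast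
next
  fix a r :: "('a, 'b) mpoly" assume a: "a \<in> face_ideal C"
  show "r * a \<in> face_ideal C"
    unfolding face_ideal_def
  proof (intro CollectI ballI notI)
    fix m assume "m \<in> Poly_Mapping.keys (r * a)" and C: "Poly_Mapping.keys m \<in> C"
    then obtain s t where "m = s + t" "t \<in> Poly_Mapping.keys a" using keys_mult[of r a] by auto
    then have "Poly_Mapping.keys t \<subseteq> Poly_Mapping.keys m" by (simp add: keys_plus_nat)
    then have "Poly_Mapping.keys t \<in> C" using assms C unfolding simplicial_complex_def by blast
    then show False using a \<open>t \<in> _\<close> by (simp add: face_ideal_def)
  qed
qed (simp add: face_ideal_def)

text \<open>Multiplying by the variable adds \<open>v\<close> to every support. For a complex
  \<open>C\<close> the new family is the closed star of \<open>v\<close>, that is, the link with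
  \<open>v\<close> as a cone point, since \<open>S\<close> is free to contain \<open>v\<close> or
  not.\<close>

lemma colon_face_ideal:
  "colon (face_ideal C) (var v) = face_ideal {S. insert v S \<in> C}"
  by (auto simp: colon_def face_ideal_def keys_single_one_mult keys_plus_nat)

text \<open>This is the deletion of \<open>v\<close>. Terms divisible by the variable are multiples
  of the new generator; for the other terms, having support outside the deletion is the same as
  having support outside \<open>C\<close>.\<close>

lemma adjoin_face_ideal:
  assumes "simplicial_complex C"
  shows "adjoin (face_ideal C) (var v :: ('v, 'k::field) mpoly) = face_ideal {S \<in> C. v \<notin> S}"
    (is "_ = ?J")
proof (rule subset_antisym)
  have C': "simplicial_complex {S \<in> C. v \<notin> S}" using assms unfolding simplicial_complex_def by blast
  show "adjoin (face_ideal C) (var v) \<subseteq> ?J"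
    by (rule adjoin_least[OF ring_ideal_face_ideal[OF C']]) (auto simp: face_ideal_def)
  show "?J \<subseteq> adjoin (face_ideal C) (var v :: ('v, 'k) mpoly)"
  proof
    fix p :: "('v, 'k) mpoly" assume p: "p \<in> ?J"
    let ?p1 = "restrict_keys (\<lambda>m. v \<in> Poly_Mapping.keys m) p"
    let ?p2 = "restrict_keys (\<lambda>m. v \<notin> Poly_Mapping.keys m) p"
    have A: "ring_ideal (adjoin (face_ideal C) (var v :: ('v, 'k) mpoly))"
      by (intro ring_ideal_adjoin ring_ideal_face_ideal assms)
    have "?p2 \<in> face_ideal C" using p by (auto simp: face_ideal_def keys_restrict_keys)
    moreover have "?p1 \<in> adjoin (face_ideal C) (var v)"
    proof (subst poly_mapping_sum_single, rule ring_ideal_sum[OF A])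
      fix m assume m: "m \<in> Poly_Mapping.keys ?p1"
      then have "Poly_Mapping.lookup m v \<ge> 1" by (auto simp: keys_restrict_keys in_keys_iff)
      then have "m = Poly_Mapping.single v 1 + (m - Poly_Mapping.single v 1)"
        by (intro poly_mapping_eqI) (auto simp: lookup_add lookup_minus lookup_single when_def)
      then have "Poly_Mapping.single m (Poly_Mapping.lookup ?p1 m) =
          var v * Poly_Mapping.single (m - Poly_Mapping.single v 1) (Poly_Mapping.lookup ?p1 m)"
        by (simp add: mult_single)
      also have "\<dots> \<in> adjoin (face_ideal C) (var v)"
        by (rule adjoin_gen) (rule ring_ideal_face_ideal[OF assms])
      finally show "Poly_Mapping.single m (Poly_Mapping.lookup ?p1 m) \<in> adjoin (face_ideal C) (var v)" .
    qed
    ultimately have "?p1 + ?p2 \<in> adjoin (face_ideal C) (var v)"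
      using ring_ideal_add[OF A] adjoin_base by blast
    then show "p \<in> adjoin (face_ideal C) (var v)" by (simp flip: restrict_keys_split)
  qed
qed

section \<open>Gradings and permutation of regular sequences\<close>

definition monomial_degree :: "('v \<Rightarrow>\<^sub>0 nat) \<Rightarrow> nat" where
  "monomial_degree m = (\<Sum>v\<in>Poly_Mapping.keys m. Poly_Mapping.lookup m v)"

lemma monomial_degree_superset:
  assumes "finite A" "Poly_Mapping.keys m \<subseteq> A"
  shows "monomial_degree m = (\<Sum>v\<in>A. Poly_Mapping.lookup m v)"
  unfolding monomial_degree_def
      using assms by (intro sum.mono_neutral_left) (auto simp: in_keys_iff)

lemma monomial_degree_add: "monomial_degree (m + n) = monomial_degree m + monomial_degree n"
proof -
  let ?A = "Poly_Mapping.keys m \<union> Poly_Mapping.keys n"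
  have "finite ?A" by simp
  then show ?thesis
    using monomial_degree_superset[of ?A m] monomial_degree_superset[of ?A n]
      monomial_degree_superset[of ?A "m + n"]
    by (simp add: keys_plus_nat lookup_add sum.distrib)
qed

lemma monomial_degree_zero [simp]: "monomial_degree 0 = 0"
  by (simp add: monomial_degree_def)

definition homogeneous :: "('v, 'k::field) mpoly \<Rightarrow> nat \<Rightarrow> bool" where
  "homogeneous f d \<longleftrightarrow> (\<forall>m\<in>Poly_Mapping.keys f. monomial_degree m = d)"

abbreviation component :: "nat \<Rightarrow> ('v, 'k::field) mpoly \<Rightarrow> ('v, 'k) mpoly" where
  "component d \<equiv> restrict_keys (\<lambda>m. monomial_degree m = d)"

definition graded :: "('v, 'k::field) mpoly set \<Rightarrow> bool" where
  "graded J \<longleftrightarrow> (\<forall>p\<in>J. \<forall>d. component d p \<in> J)"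

lemma component_homogeneous_mult:
  assumes "homogeneous f a"
  shows "component (a + d) (f * y) = f * component d y"
proof -
  let ?y = "restrict_keys (\<lambda>m. monomial_degree m \<noteq> d) y"
  have deg: "\<exists>n \<in> Poly_Mapping.keys z. monomial_degree m = a + monomial_degree n"
    if "m \<in> Poly_Mapping.keys (f * z)" for m z
    using that keys_mult[of f z] assms by (fastforce simp: homogeneous_def monomial_degree_add)
  have "f * y = f * component d y + f * ?y"
    unfolding distrib_left[symmetric] by (simp flip: restrict_keys_split)
  moreover have "component (a + d) (f * component d y) = f * component d y"
    by (rule restrict_keys_id) (use deg in \<open>fastforce simp: keys_restrict_keys\<close>)
  moreover have "component (a + d) (f * ?y) = 0"
    by (rule restrict_keys_eq_0) (use deg in \<open>fastforce simp: keys_restrict_keys\<close>)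
  ultimately show ?thesis by (simp add: restrict_keys_add)
qed

lemma component_homogeneous_mult_less:
  assumes "homogeneous f a" "d < a"
  shows "component d (f * y) = 0"
proof (rule restrict_keys_eq_0)
  fix m assume "m \<in> Poly_Mapping.keys (f * y)"
  then obtain s t where "m = s + t" "s \<in> Poly_Mapping.keys f" using keys_mult[of f y] by auto
  then show "monomial_degree m \<noteq> d"
    using assms by (simp add: homogeneous_def monomial_degree_add)
qed

lemma graded_face_ideal: "graded (face_ideal C)"
  by (auto simp: graded_def face_ideal_def keys_restrict_keys)

lemma graded_adjoin:
  assumes "ring_ideal J" "graded J" "homogeneous f a"
  shows "graded (adjoin J f)"
  unfolding graded_def
proof (intro ballI allI)
  fix p d assume "p \<in> adjoin J f"
  then obtain r where "p - f * r \<in> J" unfolding adjoin_iff by blast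
  then have r: "component d p - component d (f * r) \<in> J"
    using assms(2) unfolding graded_def restrict_keys_diff[symmetric] by blast
  show "component d p \<in> adjoin J f"
  proof (cases "d < a")
    case True
    then show ?thesis
      using r component_homogeneous_mult_less[OF assms(3)] by (auto intro: adjoin_base)
  next
    case False
    then have "component d (f * r) = f * component (d - a) r"
      using component_homogeneous_mult[OF assms(3), of "d - a"] by simp
    with r show ?thesis unfolding adjoin_iff by metis
  qed
qed

lemma homogeneous_power: "homogeneous f a \<Longrightarrow> homogeneous (f ^ n) (n * a)"
proof (induction n)
  case (Suc n)
  show ?case
    unfolding homogeneous_def
  proof
    fix m assume "m \<in> Poly_Mapping.keys (f ^ Suc n)"
    then obtain s t where "m = s + t" "s \<in> Poly_Mapping.keys f" "t \<in> Poly_Mapping.keys (f ^ n)"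
      using keys_mult[of f "f ^ n"] by auto
    then show "monomial_degree m = Suc n * a"
      using Suc by (simp add: homogeneous_def monomial_degree_add)
  qed
qed (simp add: homogeneous_def)

text \<open>Graded stand-in for Krull's intersection theorem: a multiple of \<open>x ^ Suc d\<close>
  has no component of degree \<open>d\<close>, because \<open>Suc d * a > d\<close>. Hence every
  component of \<open>y\<close> already lies in \<open>J\<close>.\<close>

lemma graded_separated:
  assumes J: "ring_ideal J" "graded J" and x: "homogeneous x a" "a > 0"
    and y: "\<And>n. y \<in> adjoin J (x ^ n)"
  shows "y \<in> J"
proof -
  have comp: "component d y \<in> J" for d
  proof -
    obtain r where "y - x ^ Suc d * r \<in> J" using y[of "Suc d"] unfolding adjoin_iff by blast
    then have "component d y - component d (x ^ Suc d * r) \<in> J"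
      using J(2) unfolding graded_def restrict_keys_diff[symmetric] by blast
    moreover have "d < Suc d * a" using x(2) by (cases a) auto
    ultimately show ?thesis
      using component_homogeneous_mult_less[OF homogeneous_power[OF x(1)], of d "Suc d" r]
      by (simp del: power_Suc)
  qed
  have "y = (\<Sum>d\<in>monomial_degree ` Poly_Mapping.keys y. component d y)" (is "_ = ?s")
  proof (rule poly_mapping_eqI)
    fix m
    show "Poly_Mapping.lookup y m = Poly_Mapping.lookup ?s m"
      by (auto simp: lookup_sum lookup_restrict_keys in_keys_iff image_iff)
  qed
  also have "\<dots> \<in> J" by (intro ring_ideal_sum J comp)
  finally show ?thesis .
qed

text \<open>If \<open>f * y\<close> lies in \<open>J\<close>, then \<open>y\<close> is divisible by
  \<open>x\<close> modulo \<open>J\<close>, and the quotient is again killed by \<open>f\<close>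
  because \<open>x\<close> can be cancelled. Repeating this puts \<open>y\<close> into
  \<open>adjoin J (x ^ n)\<close> for all \<open>n\<close>, and \<open>graded_separated\<close>
  applies.\<close>

lemma nonzerodivisor_mod_swap_graded:
  assumes J: "ring_ideal J" "graded J" and x: "homogeneous x a" "a > 0"
    and "nonzerodivisor_mod J x" "nonzerodivisor_mod (adjoin J x) f"
  shows "nonzerodivisor_mod J f"
  unfolding nonzerodivisor_mod_def
proof (intro allI impI)
  fix y assume y: "f * y \<in> J"
  have "\<exists>w. y - x ^ n * w \<in> J \<and> f * w \<in> J" for n
  proof (induction n)
    case 0
    show ?case using y ring_ideal_zero[OF J(1)] by (intro exI[of _ y]) simp
  next
    case (Suc n)
    then obtain w where w: "y - x ^ n * w \<in> J" "f * w \<in> J" by blast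
    then have "w \<in> adjoin J x"
      using assms(6) unfolding nonzerodivisor_mod_def by (blast intro: adjoin_base)
    then obtain u where u: "w - x * u \<in> J" unfolding adjoin_iff by blast
    have "f * w - f * (w - x * u) \<in> J"
      using ring_ideal_diff[OF J(1) w(2)] ring_ideal_mult[OF J(1) u] by blast
    then have "x * (f * u) \<in> J" by (simp add: algebra_simps)
    then have "f * u \<in> J" using assms(5) unfolding nonzerodivisor_mod_def by blast
    moreover have "(y - x ^ n * w) + x ^ n * (w - x * u) \<in> J"
      using ring_ideal_add[OF J(1) w(1)] ring_ideal_mult[OF J(1) u] by blast
    then have "y - x ^ Suc n * u \<in> J" by (simp add: algebra_simps)
    ultimately show ?case by blast
  qed
  then show "y \<in> J" by (intro graded_separated[OF J x]) (auto simp: adjoin_iff)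
qed

text \<open>The half of the exchange that holds in every ring: in a relation $xz = fy$ modulo
  \<open>J\<close>, the factor \<open>y\<close> is a multiple of \<open>x\<close>, and cancelling
  \<open>x\<close> exhibits \<open>z\<close> as a multiple of \<open>f\<close>.\<close>

lemma nonzerodivisor_mod_swap:
  assumes J: "ring_ideal J" and "nonzerodivisor_mod J x" "nonzerodivisor_mod (adjoin J x) f"
  shows "nonzerodivisor_mod (adjoin J f) x"
  unfolding nonzerodivisor_mod_def
proof (intro allI impI)
  fix z assume "x * z \<in> adjoin J f"
  then obtain y where y: "x * z - f * y \<in> J" unfolding adjoin_iff by blast
  then have "x * z - (x * z - f * y) \<in> adjoin J x"
    by (intro ring_ideal_diff[OF ring_ideal_adjoin[OF J]] adjoin_gen[OF J] adjoin_base)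
  then have "y \<in> adjoin J x" using assms(3) by (simp add: nonzerodivisor_mod_def)
  then obtain w where w: "y - x * w \<in> J" unfolding adjoin_iff by blast
  have "(x * z - f * y) + f * (y - x * w) \<in> J"
    using ring_ideal_add[OF J y] ring_ideal_mult[OF J w] by blast
  then have "x * (z - f * w) \<in> J" by (simp add: algebra_simps)
  then have "z - f * w \<in> J" using assms(2) unfolding nonzerodivisor_mod_def by blast
  then show "z \<in> adjoin J f" unfolding adjoin_iff by blast
qed

text \<open>The element \<open>x\<close> passes the members of \<open>fs\<close> one by one.
  Positive degree is asked of \<open>x\<close>, whose powers must separate; homogeneity of the
  members of \<open>fs\<close> keeps the successive ideals graded.\<close>

lemma weakly_regular_rotate:
  assumes "ring_ideal J" "graded J" "homogeneous x a" "a > 0"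
    and "\<And>f. f \<in> set fs \<Longrightarrow> \<exists>d. homogeneous f d" "weakly_regular J (x # fs)"
  shows "weakly_regular J (fs @ [x])"
  using assms
proof (induction fs arbitrary: J)
  case (Cons f fs)
  note J = Cons.prems(1,2)
  have x: "nonzerodivisor_mod J x" and f: "nonzerodivisor_mod (adjoin J x) f"
    and fs: "weakly_regular (adjoin (adjoin J x) f) fs"
    using Cons.prems(6) by simp_all
  obtain d where d: "homogeneous f d" using Cons.prems(5)[of f] by auto
  have "weakly_regular (adjoin J f) (fs @ [x])"
  proof (rule Cons.IH)
    show "ring_ideal (adjoin J f)" by (rule ring_ideal_adjoin[OF J(1)])
    show "graded (adjoin J f)" by (rule graded_adjoin[OF J d])
    show "weakly_regular (adjoin J f) (x # fs)"
      using nonzerodivisor_mod_swap[OF J(1) x f] fs by (simp add: adjoin_commute[of J f x])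
  qed (use Cons.prems in auto)
  moreover have "nonzerodivisor_mod J f"
    by (rule nonzerodivisor_mod_swap_graded[OF J Cons.prems(3,4) x f])
  ultimately show ?case by simp
qed simp

section \<open>Elementary symmetric polynomials as parameters\<close>

definition squarefree_monomial :: "'v set \<Rightarrow> 'v \<Rightarrow>\<^sub>0 nat" where
  "squarefree_monomial S = (\<Sum>v\<in>S. Poly_Mapping.single v 1)"

lemma lookup_squarefree_monomial:
  "finite S \<Longrightarrow> Poly_Mapping.lookup (squarefree_monomial S) v = (if v \<in> S then 1 else 0)"
  by (simp add: squarefree_monomial_def lookup_sum lookup_single when_def)

lemma keys_squarefree_monomial: "finite S \<Longrightarrow> Poly_Mapping.keys (squarefree_monomial S) = S"
  by (auto simp: in_keys_iff lookup_squarefree_monomial split: if_splits)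

lemma monomial_degree_squarefree_monomial:
  "finite S \<Longrightarrow> monomial_degree (squarefree_monomial S) = card S"
  by (simp add: monomial_degree_def keys_squarefree_monomial lookup_squarefree_monomial)

lemma prod_var: "finite S \<Longrightarrow> (\<Prod>v\<in>S. var v) = Poly_Mapping.single (squarefree_monomial S) 1"
  by (induction S rule: finite_induct) (simp_all add: squarefree_monomial_def mult_single)

definition elementary_symmetric :: "'v set \<Rightarrow> nat \<Rightarrow> ('v, 'k::field) mpoly" where
  "elementary_symmetric V i =
     (\<Sum>S | S \<subseteq> V \<and> card S = i. Poly_Mapping.single (squarefree_monomial S) 1)"

definition elementary_symmetrics :: "'v set \<Rightarrow> nat \<Rightarrow> ('v, 'k::field) mpoly list" where
  "elementary_symmetrics V t = map (\<lambda>i. elementary_symmetric V (Suc i)) [0..<t]"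

lemma keys_elementary_symmetric:
  assumes "finite V" "m \<in> Poly_Mapping.keys (elementary_symmetric V i :: ('v, 'k::field) mpoly)"
  shows "\<exists>S \<subseteq> V. card S = i \<and> m = squarefree_monomial S"
proof -
  have "m \<in> (\<Union>S\<in>{S. S \<subseteq> V \<and> card S = i}.
      Poly_Mapping.keys (Poly_Mapping.single (squarefree_monomial S) (1::'k)))"
    using assms(2) unfolding elementary_symmetric_def by (rule subsetD[OF keys_sum])
  then show ?thesis by auto
qed

lemma homogeneous_elementary_symmetric:
  assumes "finite V"
  shows "homogeneous (elementary_symmetric V i) i"
  unfolding homogeneous_def
  by (metis assms finite_subset keys_elementary_symmetric monomial_degree_squarefree_monomial)

lemma simplicial_complex_Pow: "simplicial_complex (Pow F)"
  by (auto simp: simplicial_complex_def)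

lemma nonzerodivisor_mod_var:
  assumes "v \<in> F"
  shows "nonzerodivisor_mod (face_ideal (Pow F)) (var v)"
proof -
  have "{S. insert v S \<in> Pow F} = Pow F" using assms by auto
  then have "colon (face_ideal (Pow F)) (var v) = face_ideal (Pow F)"
    unfolding colon_face_ideal by simp
  then show ?thesis unfolding nonzerodivisor_mod_def colon_def by blast
qed

text \<open>
  Killing a variable $v \in F$ passes to $F \setminus \{v\}$, and by homogeneity $v$ may be moved to the
  end of the sequence. Modulo the variables outside \<open>F\<close>, the last polynomial, of degree \<open>card F\<close>, is
  the product of the variables in \<open>F\<close>.
\<close>

lemma weakly_regular_elementary_symmetrics_Pow:
  assumes "finite V" "F \<subseteq> V" "t \<le> card F"
  shows "weakly_regular (face_ideal (Pow F)) (elementary_symmetrics V t :: ('v, 'k::field) mpoly list)"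
proof -
  have "finite F" using assms finite_subset by auto
  then show ?thesis using assms(2,3)
  proof (induction F arbitrary: t rule: finite_psubset_induct)
    case (psubset F)
    let ?J = "face_ideal (Pow F) :: ('v, 'k) mpoly set"
    have J: "ring_ideal ?J" by (rule ring_ideal_face_ideal[OF simplicial_complex_Pow])
    \<comment> \<open>With \<open>v\<close> in front, the remaining list is regular by induction for
      \<open>F - {v}\<close>, which still has at least \<open>s\<close> elements; then
      \<open>v\<close> is moved behind it.\<close>
    have rotate: "weakly_regular ?J (elementary_symmetrics V s @ [var v])"
      if "v \<in> F" "s < card F" for v s
    proof (rule weakly_regular_rotate[OF J graded_face_ideal])
      show "homogeneous (var v :: ('v, 'k) mpoly) 1"
        by (simp add: homogeneous_def monomial_degree_def)
      show "\<exists>d. homogeneous f d" if "f \<in> set (elementary_symmetrics V s)" for f :: "('v, 'k) mpoly"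
        using that homogeneous_elementary_symmetric[OF assms(1)]
        by (auto simp: elementary_symmetrics_def)
      have "{S \<in> Pow F. v \<notin> S} = Pow (F - {v})" by auto
      then have "adjoin ?J (var v) = face_ideal (Pow (F - {v}))"
        using adjoin_face_ideal[OF simplicial_complex_Pow, of F v] by simp
      moreover have "weakly_regular (face_ideal (Pow (F - {v})))
          (elementary_symmetrics V s :: ('v, 'k) mpoly list)"
        using that psubset.prems psubset.hyps by (intro psubset.IH) auto
      ultimately show "weakly_regular ?J (var v # elementary_symmetrics V s)"
        using nonzerodivisor_mod_var[OF that(1)] by simp
    qed simp
    show ?case
    proof (cases "t < card F")
      case True
      then obtain v where "v \<in> F" by fastforce
      from rotate[OF this True] show ?thesis by (simp add: weakly_regular_append)
    next
      case False
      then have t: "t = card F" using psubset.prems by simp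
      show ?thesis
      proof (cases t)
        case 0
        then show ?thesis by (simp add: elementary_symmetrics_def)
      next
        case (Suc s)
        define K where "K = foldl adjoin ?J (elementary_symmetrics V s)"
        have K: "ring_ideal K" unfolding K_def by (rule ring_ideal_foldl_adjoin[OF J])
        \<comment> \<open>Since \<open>rotate\<close> works for each \<open>v\<close> in
          \<open>F\<close> with the same list, all variables of \<open>F\<close> are nonzerodivisors
          modulo the same ideal \<open>K\<close>, hence so is their product.\<close>
        have reg: "weakly_regular ?J (elementary_symmetrics V s)"
          and nzd: "nonzerodivisor_mod K (var v)" if "v \<in> F" for v
          using rotate[OF that, of s] Suc t by (simp_all add: weakly_regular_append K_def)
        have "F \<noteq> {}" using t Suc by auto
        have "nonzerodivisor_mod K (\<Prod>v\<in>F. var v)" by (rule nonzerodivisor_mod_prod[OF nzd])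
        then have nzdF: "nonzerodivisor_mod K (Poly_Mapping.single (squarefree_monomial F) 1)"
          unfolding prod_var[OF psubset.hyps(1)] .
        have fin: "finite {S. S \<subseteq> V \<and> card S = t}" using assms(1) by simp
        have "elementary_symmetric V t - Poly_Mapping.single (squarefree_monomial F) 1 =
           (\<Sum>S\<in>{S. S \<subseteq> V \<and> card S = t} - {F}. Poly_Mapping.single (squarefree_monomial S) (1::'k))"
          unfolding elementary_symmetric_def using t psubset.prems
          by (subst sum.remove[OF fin, of F]) auto
        \<comment> \<open>A set with \<open>card F\<close> elements other than \<open>F\<close> is
          not contained in \<open>F\<close>, so its monomial vanishes modulo the prime of
          \<open>F\<close>.\<close>
        also have "\<dots> \<in> ?J"
        proof (rule ring_ideal_sum[OF J])
          fix S assume S: "S \<in> {S. S \<subseteq> V \<and> card S = t} - {F}"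
          then have "\<not> S \<subseteq> F" using t psubset.hyps card_subset_eq by auto
          moreover have "finite S" using S assms(1) finite_subset by auto
          ultimately show "Poly_Mapping.single (squarefree_monomial S) (1::'k) \<in> ?J"
            by (simp add: face_ideal_def keys_squarefree_monomial)
        qed
        finally have "elementary_symmetric V t - Poly_Mapping.single (squarefree_monomial F) 1 \<in> K"
          unfolding K_def by (rule foldl_adjoin_base)
        from nonzerodivisor_mod_cong[OF K this nzdF]
        have "nonzerodivisor_mod K (elementary_symmetric V t)" .
        then show ?thesis
          using reg \<open>F \<noteq> {}\<close> Suc
          by (auto simp: elementary_symmetrics_def weakly_regular_append K_def)
      qed
    qed
  qed
qed

section \<open>Vertex decomposable graphs\<close>

lemma dominates_delete_verts:
  "u \<rightarrow>\<^bsub>delete_verts G S\<^esub> v \<longleftrightarrow> u \<in> verts G - S \<and> v \<in> verts G - S \<and> u \<rightarrow>\<^bsub>G\<^esub> v"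
  by (auto simp: delete_verts_def arcs_ends_def arc_to_ends_def)

lemma verts_delete_verts: "verts (delete_verts G S) = verts G - S"
  by (simp add: delete_verts_def)

lemma independent_set_delete_verts:
  "independent_set (delete_verts G S) T \<longleftrightarrow> independent_set G T \<and> T \<inter> S = {}"
  by (auto simp: independent_set_def verts_delete_verts dominates_delete_verts)

lemma independent_set_mono: "independent_set G T \<Longrightarrow> S \<subseteq> T \<Longrightarrow> independent_set G S"
  unfolding independent_set_def by blast

lemma maximal_independent_superset:
  assumes "finite (verts G)" "independent_set G S"
  shows "\<exists>F. maximal_independent_set G F \<and> S \<subseteq> F"
proof -
  have sub: "{T. independent_set G T \<and> S \<subseteq> T} \<subseteq> Pow (verts G)"
    by (auto simp: independent_set_def)
  have "finite {T. independent_set G T \<and> S \<subseteq> T}"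
    using finite_subset[OF sub] assms(1) by simp
  then obtain F where F: "independent_set G F" "S \<subseteq> F"
    and max: "\<forall>T\<in>{T. independent_set G T \<and> S \<subseteq> T}. F \<subseteq> T \<longrightarrow> F = T"
    using finite_has_maximal2[of "{T. independent_set G T \<and> S \<subseteq> T}" S] assms(2) by auto
  have "maximal_independent_set G F"
    unfolding maximal_independent_set_def using F max by blast
  then show ?thesis using F by blast
qed

text \<open>For \<open>U\<close> disjoint from the vertices this is the join of the independence
  complex with the full simplex on \<open>U\<close>.\<close>

definition independence_cone :: "('v, 'e) pre_digraph \<Rightarrow> 'v set \<Rightarrow> 'v set set" where
  "independence_cone G U = {S. S \<subseteq> verts G \<union> U \<and> independent_set G (S \<inter> verts G)}"

lemma simplicial_complex_independence_cone: "simplicial_complex (independence_cone G U)"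
  unfolding simplicial_complex_def independence_cone_def
  by (auto intro: independent_set_mono)

text \<open>Transfers the lower bound on facet sizes to the link: a facet there is one vertex
  smaller than a facet of \<open>G\<close>, and this loss is made up when \<open>x\<close> joins the
  cone vertices.\<close>

lemma maximal_independent_insert:
  assumes sym: "\<And>u v. u \<rightarrow>\<^bsub>G\<^esub> v \<Longrightarrow> v \<rightarrow>\<^bsub>G\<^esub> u" and irrefl: "\<And>u. \<not> u \<rightarrow>\<^bsub>G\<^esub> u"
    and x: "x \<in> verts G"
    and F: "maximal_independent_set (delete_verts G (closed_neighborhood G x)) F"
  shows "maximal_independent_set G (insert x F)"
proof -
  have indep: "independent_set G F" "F \<inter> closed_neighborhood G x = {}"
    using F by (auto simp: maximal_independent_set_def independent_set_delete_verts)
  then have no_edge: "\<not> x \<rightarrow>\<^bsub>G\<^esub> u" "\<not> u \<rightarrow>\<^bsub>G\<^esub> x" if "u \<in> F" for u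
    using that sym by (auto simp: closed_neighborhood_def independent_set_def)
  show ?thesis
    unfolding maximal_independent_set_def
  proof (intro conjI allI impI)
    show "independent_set G (insert x F)"
      using indep no_edge x irrefl by (auto simp: independent_set_def)
    fix T assume T: "independent_set G T \<and> insert x F \<subseteq> T"
    have "independent_set (delete_verts G (closed_neighborhood G x)) (T - {x})"
      unfolding independent_set_delete_verts
      using T by (auto simp: independent_set_def closed_neighborhood_def)
    moreover have "F \<subseteq> T - {x}" using T indep(2) by (auto simp: closed_neighborhood_def)
    ultimately have "T - {x} = F" using F by (auto simp: maximal_independent_set_def)
    then show "T = insert x F" using T by blast
  qed
qed

text \<open>Condition (ii) for a shedding vertex enters here: a facet of the deletion that is not
  independent in the link contains a neighbour of \<open>x\<close>, so \<open>x\<close> cannot be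
  added to it. Facets of the deletion therefore obey the bound for \<open>G\<close>.\<close>

lemma maximal_independent_shedding:
  assumes F: "maximal_independent_set (delete_verts G {x}) F"
    and "\<not> independent_set (delete_verts G (closed_neighborhood G x)) F"
  shows "maximal_independent_set G F"
proof -
  have indep: "independent_set G F" "x \<notin> F"
    using F by (auto simp: maximal_independent_set_def independent_set_delete_verts)
  then obtain u where u: "u \<in> F" "x \<rightarrow>\<^bsub>G\<^esub> u"
    using assms(2) by (auto simp: independent_set_delete_verts closed_neighborhood_def)
  show ?thesis
    unfolding maximal_independent_set_def
  proof (intro conjI allI impI indep)
    fix T assume T: "independent_set G T \<and> F \<subseteq> T"
    then have "x \<notin> T" using u by (auto simp: independent_set_def)
    then have "independent_set (delete_verts G {x}) T"
      using T by (simp add: independent_set_delete_verts)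
    then show "T = F" using F T by (auto simp: maximal_independent_set_def)
  qed
qed

text \<open>Compatibility with \<open>x\<close> excludes exactly the neighbours of \<open>x\<close>
  from \<open>S\<close>, while membership of \<open>x\<close> itself becomes free: a vertex turns
  into a cone point.\<close>

lemma independence_cone_link:
  assumes sym: "\<And>u v. u \<rightarrow>\<^bsub>G\<^esub> v \<Longrightarrow> v \<rightarrow>\<^bsub>G\<^esub> u" and irrefl: "\<And>u. \<not> u \<rightarrow>\<^bsub>G\<^esub> u"
    and x: "x \<in> verts G" and "U \<inter> verts G = {}"
  shows "{S. insert x S \<in> independence_cone G U} =
    independence_cone (delete_verts G (closed_neighborhood G x)) (insert x U)"
proof (intro Set.set_eqI iffI)
  fix S assume "S \<in> {S. insert x S \<in> independence_cone G U}"
  then have S: "S \<subseteq> verts G \<union> U" "independent_set G (insert x (S \<inter> verts G))"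
    using x by (auto simp: independence_cone_def)
  then have "\<not> x \<rightarrow>\<^bsub>G\<^esub> u" if "u \<in> S \<inter> verts G" for u
    using that by (auto simp: independent_set_def)
  moreover have "independent_set G (S \<inter> (verts G - closed_neighborhood G x))"
    by (rule independent_set_mono[OF S(2)]) blast
  ultimately show "S \<in> independence_cone (delete_verts G (closed_neighborhood G x)) (insert x U)"
    using S(1)
    by (auto simp: independence_cone_def verts_delete_verts independent_set_delete_verts
        closed_neighborhood_def)
next
  fix S assume "S \<in> independence_cone (delete_verts G (closed_neighborhood G x)) (insert x U)"
  then have S: "S \<subseteq> (verts G - closed_neighborhood G x) \<union> insert x U"
    and indep: "independent_set G (S \<inter> (verts G - closed_neighborhood G x))"
    by (auto simp: independence_cone_def verts_delete_verts independent_set_delete_verts)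
  have eq: "insert x S \<inter> verts G = insert x (S \<inter> (verts G - closed_neighborhood G x))"
    using S x assms(4) by (auto simp: closed_neighborhood_def)
  have "\<not> x \<rightarrow>\<^bsub>G\<^esub> u \<and> \<not> u \<rightarrow>\<^bsub>G\<^esub> x" if "u \<in> S \<inter> (verts G - closed_neighborhood G x)" for u
    using that sym by (auto simp: closed_neighborhood_def)
  then have "independent_set G (insert x (S \<inter> (verts G - closed_neighborhood G x)))"
    using indep irrefl x by (auto simp: independent_set_def)
  then show "S \<in> {S. insert x S \<in> independence_cone G U}"
    using S x eq by (auto simp: independence_cone_def)
qed

lemma independence_cone_deletion:
  assumes "U \<inter> verts G = {}" "x \<in> verts G"
  shows "{S \<in> independence_cone G U. x \<notin> S} = independence_cone (delete_verts G {x}) U"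
proof (rule Set.set_eqI)
  fix S
  show "S \<in> {S \<in> independence_cone G U. x \<notin> S} \<longleftrightarrow> S \<in> independence_cone (delete_verts G {x}) U"
  proof (cases "x \<in> S")
    case True
    then show ?thesis using assms by (auto simp: independence_cone_def verts_delete_verts)
  next
    case False
    then have "S \<inter> (verts G - {x}) = S \<inter> verts G" by blast
    then show ?thesis
      using False
      by (auto simp: independence_cone_def verts_delete_verts independent_set_delete_verts)
  qed
qed

text \<open>
  The induction passes to links, where the shedding vertex becomes a cone point; hence the
  extra cone vertices \<open>U\<close>.
\<close>

lemma weakly_regular_vertex_decomposable:
  assumes "vertex_decomposable G"
    and "\<And>u v. u \<rightarrow>\<^bsub>G\<^esub> v \<Longrightarrow> v \<rightarrow>\<^bsub>G\<^esub> u" "\<And>u. \<not> u \<rightarrow>\<^bsub>G\<^esub> u"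
    and "finite V" "verts G \<union> U \<subseteq> V" "U \<inter> verts G = {}"
    and "\<And>F. maximal_independent_set G F \<Longrightarrow> t \<le> card F + card U"
  shows "weakly_regular (face_ideal (independence_cone G U))
    (elementary_symmetrics V t :: ('v, 'k::field) mpoly list)"
  using assms
proof (induction G arbitrary: U rule: vertex_decomposable.induct)
  case (edgeless G)
  have fin: "finite (verts G)" "finite U"
    using edgeless.prems(3,4) by (meson finite_Un finite_subset)+
  have indep: "independent_set G S \<longleftrightarrow> S \<subseteq> verts G" for S
    using edgeless.hyps by (auto simp: independent_set_def arcs_ends_def)
  then have "maximal_independent_set G (verts G)" by (auto simp: maximal_independent_set_def)
  \<comment> \<open>Without edges the vertex set is a facet, so the bound on \<open>t\<close> is the
    number of vertices of the full simplex on \<open>verts G \<union> U\<close>.\<close>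
  then have "t \<le> card (verts G \<union> U)"
    using edgeless.prems(5,6) fin by (subst card_Un_disjoint) auto
  moreover have "independence_cone G U = Pow (verts G \<union> U)"
    using indep by (auto simp: independence_cone_def)
  ultimately show ?case
    using edgeless.prems(3,4) by (simp add: weakly_regular_elementary_symmetrics_Pow)
next
  case (shedding x G)
  note sym = shedding.prems(1) and irrefl = shedding.prems(2)
  let ?L = "delete_verts G (closed_neighborhood G x)" and ?D = "delete_verts G {x}"
  have fin: "finite (verts G)" "finite U"
    using shedding.prems(3,4) by (meson finite_Un finite_subset)+
  have x: "x \<in> closed_neighborhood G x" "x \<notin> U"
    using shedding.hyps(1) shedding.prems(5) by (auto simp: closed_neighborhood_def)
  have L: "weakly_regular (face_ideal (independence_cone ?L (insert x U)))
      (elementary_symmetrics V t :: ('v, 'k) mpoly list)"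
  proof (rule shedding.IH(2))
    fix F assume F: "maximal_independent_set ?L F"
    then have "x \<notin> F" "finite F"
      using x fin finite_subset
      by (auto simp: maximal_independent_set_def independent_set_def verts_delete_verts)
    moreover have "t \<le> card (insert x F) + card U"
      by (rule shedding.prems(6)[OF maximal_independent_insert[OF sym irrefl shedding.hyps(1) F]])
    ultimately show "t \<le> card F + card (insert x U)" using x fin by simp
  next
    show "verts ?L \<union> insert x U \<subseteq> V" "insert x U \<inter> verts ?L = {}"
      using shedding.prems(4,5) shedding.hyps(1) x by (auto simp: verts_delete_verts)
    show "v \<rightarrow>\<^bsub>?L\<^esub> u" if "u \<rightarrow>\<^bsub>?L\<^esub> v" for u v
      using that sym[of u v] by (simp add: dominates_delete_verts)
    show "\<not> u \<rightarrow>\<^bsub>?L\<^esub> u" for u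
      using irrefl[of u] by (simp add: dominates_delete_verts)
  qed (rule shedding.prems(3))
  have D: "weakly_regular (face_ideal (independence_cone ?D U))
      (elementary_symmetrics V t :: ('v, 'k) mpoly list)"
  proof (rule shedding.IH(1))
    fix F assume F: "maximal_independent_set ?D F"
    then have "\<not> independent_set ?L F" using shedding.hyps(4) by blast
    from maximal_independent_shedding[OF F this]
    show "t \<le> card F + card U" by (rule shedding.prems(6))
  next
    show "verts ?D \<union> U \<subseteq> V" "U \<inter> verts ?D = {}"
      using shedding.prems(4,5) by (auto simp: verts_delete_verts)
    show "v \<rightarrow>\<^bsub>?D\<^esub> u" if "u \<rightarrow>\<^bsub>?D\<^esub> v" for u v
      using that sym[of u v] by (simp add: dominates_delete_verts)
    show "\<not> u \<rightarrow>\<^bsub>?D\<^esub> u" for u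
      using irrefl[of u] by (simp add: dominates_delete_verts)
  qed (rule shedding.prems(3))
  have link: "{S. insert x S \<in> independence_cone G U} = independence_cone ?L (insert x U)"
    by (rule independence_cone_link) (use sym irrefl shedding.hyps(1) shedding.prems(5) in auto)
  show ?case
  proof (rule weakly_regular_colon[OF ring_ideal_face_ideal[OF simplicial_complex_independence_cone]])
    show "weakly_regular (colon (face_ideal (independence_cone G U)) (var x))
        (elementary_symmetrics V t :: ('v, 'k) mpoly list)"
      using L unfolding colon_face_ideal link .
    show "weakly_regular (adjoin (face_ideal (independence_cone G U)) (var x))
        (elementary_symmetrics V t :: ('v, 'k) mpoly list)"
      using D unfolding adjoin_face_ideal[OF simplicial_complex_independence_cone]
        independence_cone_deletion[OF shedding.prems(5) shedding.hyps(1)] .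
  qed
qed

section \<open>Counting monomials and the bound by a facet\<close>

lemma exists_linear_relation:
  fixes M :: "'a \<Rightarrow> 'b \<Rightarrow> 'k::field"
  assumes "finite B" "finite A" "card B < card A"
  shows "\<exists>\<phi>. (\<exists>a\<in>A. \<phi> a \<noteq> 0) \<and> (\<forall>b\<in>B. (\<Sum>a\<in>A. \<phi> a * M a b) = 0)"
  using assms
proof (induction B arbitrary: A M rule: finite_induct)
  case empty
  then obtain a where "a \<in> A" by fastforce
  then show ?case by (intro exI[of _ "\<lambda>_. 1"]) auto
next
  case (insert b B)
  show ?case
  proof (cases "\<exists>a\<in>A. M a b \<noteq> 0")
    case False
    obtain \<phi> where "\<exists>a\<in>A. \<phi> a \<noteq> 0" "\<forall>b\<in>B. (\<Sum>a\<in>A. \<phi> a * M a b) = 0"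
      using insert.IH[of A M] insert.prems insert.hyps by auto
    then show ?thesis using False by (intro exI[of _ \<phi>]) auto
  next
    case True
    then obtain a0 where a0: "a0 \<in> A" "M a0 b \<noteq> 0" by blast
    let ?A = "A - {a0}"
    have "card B < card ?A" using insert.prems insert.hyps a0 by simp
    \<comment> \<open>One step of Gaussian elimination: with pivot \<open>M a0 b\<close>, column
      \<open>b\<close> is cleared in every other row.\<close>
    define M' where "M' a c = M a c - M a b / M a0 b * M a0 c" for a c
    obtain \<phi> where \<phi>: "\<exists>a\<in>?A. \<phi> a \<noteq> 0" "\<forall>c\<in>B. (\<Sum>a\<in>?A. \<phi> a * M' a c) = 0"
      using insert.IH[of ?A M'] \<open>card B < card ?A\<close> insert.prems(1) by blast
    \<comment> \<open>A relation among the reduced rows is one among the original rows once the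
      pivot row receives the coefficient \<open>- s\<close> that the elimination took out.\<close>
    define s where "s = (\<Sum>a\<in>?A. \<phi> a * (M a b / M a0 b))"
    define \<psi> where "\<psi> = \<phi>(a0 := - s)"
    have sum: "(\<Sum>a\<in>A. \<psi> a * M a c) = (\<Sum>a\<in>?A. \<phi> a * M a c) - s * M a0 c" for c
    proof -
      have "(\<Sum>a\<in>A. \<psi> a * M a c) = \<psi> a0 * M a0 c + (\<Sum>a\<in>?A. \<psi> a * M a c)"
        by (rule sum.remove[OF insert.prems(1) a0(1)])
      also have "(\<Sum>a\<in>?A. \<psi> a * M a c) = (\<Sum>a\<in>?A. \<phi> a * M a c)"
        by (rule sum.cong) (auto simp: \<psi>_def)
      finally show ?thesis by (simp add: \<psi>_def)
    qed
    have "(\<Sum>a\<in>A. \<psi> a * M a c) = (\<Sum>a\<in>?A. \<phi> a * M' a c)" for c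
      unfolding sum s_def M'_def
      by (simp add: sum_distrib_right right_diff_distrib sum_subtractf mult.assoc)
    moreover have "M' a b = 0" for a using a0(2) by (simp add: M'_def)
    ultimately have "\<forall>c\<in>insert b B. (\<Sum>a\<in>A. \<psi> a * M a c) = 0" using \<phi>(2) by simp
    moreover have "\<exists>a\<in>A. \<psi> a \<noteq> 0" using \<phi>(1) by (auto simp: \<psi>_def)
    ultimately show ?thesis by blast
  qed
qed

lemma lookup_power_product_le:
  assumes "\<And>g m. g \<in> set gs \<Longrightarrow> m \<in> Poly_Mapping.keys g \<Longrightarrow> Poly_Mapping.lookup m v \<le> D"
    and "length \<alpha> = length gs" "set \<alpha> \<subseteq> {..N}"
        "m \<in> Poly_Mapping.keys (power_product gs \<alpha> :: ('v, 'k::field) mpoly)"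
  shows "Poly_Mapping.lookup m v \<le> length gs * (N * D)"
  using assms
proof (induction gs \<alpha> arbitrary: m rule: list_induct2')
  case (4 g gs a \<alpha>)
  have power: "Poly_Mapping.lookup m v \<le> n * D" if "m \<in> Poly_Mapping.keys (g ^ n)" for m n
    using that
  proof (induction n arbitrary: m)
    case (Suc n)
    then obtain s t where "m = s + t" "s \<in> Poly_Mapping.keys g" "t \<in> Poly_Mapping.keys (g ^ n)"
      using keys_mult[of g "g ^ n"] by auto
    then show ?case using Suc.IH[of t] 4(2)[of g s] by (simp add: lookup_add)
  qed simp
  obtain s t where st: "m = s + t" "s \<in> Poly_Mapping.keys (g ^ a)"
      "t \<in> Poly_Mapping.keys (power_product gs \<alpha>)"
    using 4(5) keys_mult[of "g ^ a" "power_product gs \<alpha>"] by auto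
  have "Poly_Mapping.lookup s v \<le> a * D" by (rule power[OF st(2)])
  also have "\<dots> \<le> N * D" using 4(4) by simp
  finally have "Poly_Mapping.lookup s v \<le> N * D" .
  moreover have "Poly_Mapping.lookup t v \<le> length gs * (N * D)"
    by (rule 4(1)) (use 4 st(3) in auto)
  ultimately show ?case by (simp add: st(1) lookup_add)
qed simp_all

text \<open>Degrees are bounded in each variable separately, so that the monomials form a box and
  are counted as functions on \<open>F\<close>.\<close>

lemma bounded_monomials:
  assumes "finite F"
  shows "finite {m. Poly_Mapping.keys m \<subseteq> F \<and> (\<forall>v. Poly_Mapping.lookup m v \<le> b)}" (is "finite ?B")
    and "card {m. Poly_Mapping.keys m \<subseteq> F \<and> (\<forall>v. Poly_Mapping.lookup m v \<le> b)} \<le> Suc b ^ card F"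
proof -
  let ?h = "\<lambda>m::'a \<Rightarrow>\<^sub>0 nat. restrict (Poly_Mapping.lookup m) F"
  have inj: "inj_on ?h ?B"
  proof (rule inj_onI)
    fix m n assume mn: "m \<in> ?B" "n \<in> ?B" "?h m = ?h n"
    show "m = n"
    proof (rule poly_mapping_eqI)
      fix v
      show "Poly_Mapping.lookup m v = Poly_Mapping.lookup n v"
      proof (cases "v \<in> F")
        case True
        then show ?thesis using fun_cong[OF mn(3), of v] by simp
      next
        case False
        then have "v \<notin> Poly_Mapping.keys m" "v \<notin> Poly_Mapping.keys n" using mn(1,2) by auto
        then show ?thesis by (simp add: in_keys_iff)
      qed
    qed
  qed
  have img: "?h ` ?B \<subseteq> (\<Pi>\<^sub>E v\<in>F. {..b})" by auto
  have fin: "finite (\<Pi>\<^sub>E v\<in>F. {..b})" using assms by (intro finite_PiE) auto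
  show "finite ?B" by (rule inj_on_finite[OF inj img fin])
  have "card ?B \<le> card (\<Pi>\<^sub>E v\<in>F. {..b})" by (rule card_inj_on_le[OF inj img fin])
  also have "\<dots> = Suc b ^ card F" using assms by (simp add: card_PiE)
  finally show "card ?B \<le> Suc b ^ card F" .
qed

text \<open>
  Counting: the $(N+1)^s$ products with exponents at most $N$ involve, modulo the variables
  outside \<open>F\<close>, only monomials in \<open>card F\<close> variables with exponents at most $sND$.
\<close>

lemma exists_polynomial_relation:
  fixes gs :: "('v, 'k::field) mpoly list"
  assumes "finite F" "card F < length gs"
  shows "\<exists>A \<phi>. finite A \<and> A \<noteq> {} \<and> (\<forall>\<alpha>\<in>A. length \<alpha> = length gs \<and> \<phi> \<alpha> dvd 1) \<and>
    (\<Sum>\<alpha>\<in>A. \<phi> \<alpha> * power_product gs \<alpha>) \<in> face_ideal (Pow F)"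
proof -
  let ?n = "card F" and ?s = "length gs"
  define E where "E = (\<Union>g\<in>set gs. \<Union>m\<in>Poly_Mapping.keys g. Poly_Mapping.lookup m ` Poly_Mapping.keys m)"
  have "finite E" by (auto simp: E_def)
  then obtain D where D: "\<And>e. e \<in> E \<Longrightarrow> e \<le> D" by (meson finite_nat_set_iff_bounded_le)
  have deg: "Poly_Mapping.lookup m v \<le> D" if "g \<in> set gs" "m \<in> Poly_Mapping.keys g" for g m v
  proof (cases "v \<in> Poly_Mapping.keys m")
    case True
    then have "Poly_Mapping.lookup m v \<in> E" using that by (auto simp: E_def)
    then show ?thesis by (rule D)
  qed (simp add: in_keys_iff)
  define N where "N = (?s * D + 1) ^ ?n"
  define b where "b = ?s * (N * D)"
  define B where "B = {m :: 'v \<Rightarrow>\<^sub>0 nat. Poly_Mapping.keys m \<subseteq> F \<and>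
      (\<forall>v. Poly_Mapping.lookup m v \<le> b)}"
  define A where "A = {\<alpha>. set \<alpha> \<subseteq> {..N} \<and> length \<alpha> = ?s}"
  have "Suc b \<le> (?s * D + 1) * Suc N" by (simp add: b_def algebra_simps)
  then have "Suc b ^ ?n \<le> ((?s * D + 1) * Suc N) ^ ?n" by (rule power_mono) simp
  also have "\<dots> = N * Suc N ^ ?n" by (subst power_mult_distrib) (simp only: N_def)
  also have "\<dots> < Suc N ^ Suc ?n" by simp
  also have "\<dots> \<le> Suc N ^ ?s" using assms(2) by (intro power_increasing) auto
  also have "\<dots> = card A" by (simp add: A_def card_lists_length_eq)
  finally have "card B < card A"
    using bounded_monomials(2)[OF assms(1), of b] unfolding B_def by linarith
  moreover have "finite B" unfolding B_def by (rule bounded_monomials(1)[OF assms(1)])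
  moreover have finA: "finite A" by (simp add: A_def finite_lists_length_eq)
  ultimately obtain c :: "nat list \<Rightarrow> 'k" where c: "\<exists>\<alpha>\<in>A. c \<alpha> \<noteq> 0"
    "\<forall>m\<in>B. (\<Sum>\<alpha>\<in>A. c \<alpha> * Poly_Mapping.lookup (power_product gs \<alpha>) m) = 0"
    using exists_linear_relation[of B A "\<lambda>\<alpha> m. Poly_Mapping.lookup (power_product gs \<alpha>) m"] by blast
  \<comment> \<open>Zero coefficients are discarded because
    \<open>ideal_chain_polynomial_relation\<close> asks for a nonempty relation whose coefficients
    are all units.\<close>
  let ?A = "{\<alpha> \<in> A. c \<alpha> \<noteq> 0}"
  have lookup_sum: "Poly_Mapping.lookup (\<Sum>\<alpha>\<in>?A. Poly_Mapping.single 0 (c \<alpha>) * power_product gs \<alpha>) m =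
      (\<Sum>\<alpha>\<in>A. c \<alpha> * Poly_Mapping.lookup (power_product gs \<alpha>) m)" for m
  proof -
    have "Poly_Mapping.lookup (\<Sum>\<alpha>\<in>?A. Poly_Mapping.single 0 (c \<alpha>) * power_product gs \<alpha>) m =
        (\<Sum>\<alpha>\<in>?A. c \<alpha> * Poly_Mapping.lookup (power_product gs \<alpha>) m)"
      using lookup_single_mult[of 0 "_ :: 'k" _ m] by (simp add: lookup_sum)
    also have "\<dots> = (\<Sum>\<alpha>\<in>A. c \<alpha> * Poly_Mapping.lookup (power_product gs \<alpha>) m)"
      by (intro sum.mono_neutral_left finA) auto
    finally show ?thesis .
  qed
  have "(\<Sum>\<alpha>\<in>?A. Poly_Mapping.single 0 (c \<alpha>) * power_product gs \<alpha>) \<in> face_ideal (Pow F)"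
    unfolding face_ideal_def
  proof (intro CollectI ballI notI)
    fix m assume m: "m \<in> Poly_Mapping.keys (\<Sum>\<alpha>\<in>?A. Poly_Mapping.single 0 (c \<alpha>) * power_product gs \<alpha>)"
      and "Poly_Mapping.keys m \<in> Pow F"
    have ne: "(\<Sum>\<alpha>\<in>A. c \<alpha> * Poly_Mapping.lookup (power_product gs \<alpha>) m) \<noteq> 0"
      using m by (simp add: in_keys_iff lookup_sum)
    then obtain \<alpha> where "\<alpha> \<in> A" "m \<in> Poly_Mapping.keys (power_product gs \<alpha>)"
      by (metis (no_types, lifting) in_keys_iff mult_zero_right sum.neutral)
    then have "Poly_Mapping.lookup m v \<le> b" for v
      using lookup_power_product_le[of gs v D \<alpha> N m] deg unfolding b_def A_def by blast
    then have "m \<in> B" using \<open>Poly_Mapping.keys m \<in> Pow F\<close> by (simp add: B_def)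
    then show False using c(2) ne by blast
  qed
  moreover have "Poly_Mapping.single 0 (c \<alpha>) dvd (1 :: ('v, 'k) mpoly)" if "\<alpha> \<in> ?A" for \<alpha>
    using that by (intro dvdI[of _ _ "Poly_Mapping.single 0 (inverse (c \<alpha>))"]) (simp add: mult_single)
  moreover have "finite ?A" "?A \<noteq> {}" using finA c(1) by auto
  moreover have "length \<alpha> = ?s" if "\<alpha> \<in> ?A" for \<alpha> using that by (simp add: A_def)
  ultimately show ?thesis
    by (intro exI[of _ ?A] exI[of _ "\<lambda>\<alpha>. Poly_Mapping.single 0 (c \<alpha>)"]) blast
qed

text \<open>A longer list would satisfy a relation modulo the prime of \<open>F\<close>; multiplied
  by \<open>z\<close> it holds modulo \<open>K\<close>, and this forces \<open>z\<close> into
  \<open>L\<close>. For depth \<open>z\<close> is $x^F$ with \<open>F\<close> a facet; for chains of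
  primes \<open>z\<close> is 1.\<close>

lemma ideal_chain_length_le:
  fixes gs :: "('v, 'k::field) mpoly list"
  assumes "ideal_chain K gs L" "finite F" "z \<notin> L"
    and "\<And>p. p \<in> face_ideal (Pow F) \<Longrightarrow> p * z \<in> K"
  shows "length gs \<le> card F"
proof (rule ccontr)
  assume "\<not> length gs \<le> card F"
  then obtain A \<phi> where "finite A" "A \<noteq> {}" "\<forall>\<alpha>\<in>A. length \<alpha> = length gs \<and> \<phi> \<alpha> dvd 1"
    "(\<Sum>\<alpha>\<in>A. \<phi> \<alpha> * power_product gs \<alpha>) \<in> face_ideal (Pow F)"
    using exists_polynomial_relation[OF assms(2), of gs] by auto
  then have "z \<in> L"
    using assms(4) by (intro ideal_chain_polynomial_relation[OF assms(1), of A \<phi>]) auto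
  then show False using assms(3) by blast
qed

text \<open>
  Since all members of \<open>fs\<close> may be replaced by high powers, the monomial $x^F$, whose
  annihilator is the prime of the facet \<open>F\<close>, avoids the ideal they generate.
\<close>

lemma weakly_regular_length_le_facet:
  fixes fs :: "('v, 'k::field) mpoly list"
  assumes C: "simplicial_complex C" and F: "F \<in> C" "\<And>T. T \<in> C \<Longrightarrow> F \<subseteq> T \<Longrightarrow> T = F" "finite F"
    and fs: "\<And>f. f \<in> set fs \<Longrightarrow> 0 \<notin> Poly_Mapping.keys f" and reg: "weakly_regular (face_ideal C) fs"
  shows "length fs \<le> card F"
proof -
  \<comment> \<open>One more than the degree of $x^F$. The ideal \<open>L\<close> adds all monomials
    of degree at least \<open>N\<close> to the face ideal; it contains the \<open>N\<close>-th
    powers, whose bases have no constant term, but not $x^F$.\<close>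
  define N where "N = Suc (card F)"
  define L :: "('v, 'k) mpoly set" where
    "L = {p. \<forall>m\<in>Poly_Mapping.keys p. Poly_Mapping.keys m \<notin> C \<or> N \<le> monomial_degree m}"
  define z :: "('v, 'k) mpoly" where "z = Poly_Mapping.single (squarefree_monomial F) 1"
  have "ring_ideal L"
  proof (rule ring_idealI)
    fix a b assume "a \<in> L" "b \<in> L"
    then show "a + b \<in> L" unfolding L_def using keys_add[of a b] by blast
  next
    fix a r assume a: "a \<in> L"
    show "r * a \<in> L"
      unfolding L_def
    proof (intro CollectI ballI)
      fix m assume "m \<in> Poly_Mapping.keys (r * a)"
      then obtain s t where st: "m = s + t"
          "t \<in> Poly_Mapping.keys a" using keys_mult[of r a] by auto
      then have "Poly_Mapping.keys t \<notin> C \<or> N \<le> monomial_degree t" using a by (simp add: L_def)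
      moreover have "Poly_Mapping.keys t \<subseteq> Poly_Mapping.keys m" by (simp add: st keys_plus_nat)
      ultimately show "Poly_Mapping.keys m \<notin> C \<or> N \<le> monomial_degree m"
        using C st by (auto simp: simplicial_complex_def monomial_degree_add)
    qed
  qed (simp add: L_def)
  moreover have "f ^ N \<in> L" if "f \<in> set fs" for f
  proof -
    have pos: "1 \<le> monomial_degree s" if "s \<in> Poly_Mapping.keys f" for s
    proof -
      have "s \<noteq> 0" using that fs[OF \<open>f \<in> set fs\<close>] by auto
      then obtain v where "Poly_Mapping.lookup s v \<noteq> 0" by (metis lookup_zero poly_mapping_eqI)
      then have "v \<in> Poly_Mapping.keys s" "1 \<le> Poly_Mapping.lookup s v" by (auto simp: in_keys_iff)
      then show ?thesis
        unfolding monomial_degree_def by (metis finite_keys member_le_sum le_trans zero_le)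
    qed
    have "n \<le> monomial_degree m" if "m \<in> Poly_Mapping.keys (f ^ n)" for m n
      using that
    proof (induction n arbitrary: m)
      case (Suc n)
      then obtain s t where "m = s + t" "s \<in> Poly_Mapping.keys f" "t \<in> Poly_Mapping.keys (f ^ n)"
        using keys_mult[of f "f ^ n"] by auto
      then show ?case using Suc.IH[of t] pos[of s] by (simp add: monomial_degree_add)
    qed simp
    then show ?thesis by (simp add: L_def)
  qed
  ultimately have "foldl adjoin (face_ideal C) (map (\<lambda>f. f ^ N) fs) \<subseteq> L"
    by (intro foldl_adjoin_least) (auto simp: L_def face_ideal_def)
  moreover have "z \<notin> L"
    using F by (simp add: L_def z_def keys_squarefree_monomial monomial_degree_squarefree_monomial N_def)
  ultimately have z: "z \<notin> foldl adjoin (face_ideal C) (map (\<lambda>f. f ^ N) fs)" by blast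
  have "p * z \<in> face_ideal C" if "p \<in> face_ideal (Pow F)" for p
    unfolding face_ideal_def
  proof (intro CollectI ballI notI)
    fix m assume "m \<in> Poly_Mapping.keys (p * z)" and "Poly_Mapping.keys m \<in> C"
    then obtain s where s: "m = squarefree_monomial F + s" "s \<in> Poly_Mapping.keys p"
      using keys_single_one_mult[of "squarefree_monomial F" p] by (auto simp: z_def mult.commute)
    \<comment> \<open>A face containing the facet \<open>F\<close> equals \<open>F\<close>, so the
      support of \<open>s\<close> would lie in \<open>F\<close>, against the choice of
      \<open>p\<close>.\<close>
    then have "Poly_Mapping.keys m = F \<union> Poly_Mapping.keys s"
        using F(3) by (simp add: keys_plus_nat keys_squarefree_monomial)
    then have "Poly_Mapping.keys s \<subseteq> F" using F(2)[OF \<open>Poly_Mapping.keys m \<in> C\<close>] by blast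
    then show False using s(2) that by (auto simp: face_ideal_def)
  qed
  moreover have J: "ring_ideal (face_ideal C :: ('v, 'k) mpoly set)"
      by (rule ring_ideal_face_ideal[OF C])
  ultimately have "length (map (\<lambda>f. f ^ N) fs) \<le> card F"
    using z F(3) ideal_chain_weakly_regular[OF J weakly_regular_powers[OF J reg]]
    by (intro ideal_chain_length_le) auto
  then show ?thesis by simp
qed

text \<open>Leading monomials multiply. The variables carry no order, so \<open>F\<close> is
  numbered by \<iota>, and \<open>enc\<close> moves exponents to
  \<open>nat \<Rightarrow>\<^sub>0 nat\<close>, whose order is linear and compatible with addition.
  Only monomials supported in \<open>F\<close> compete for the lead.\<close>

lemma face_ideal_Pow_prime:
  fixes p q :: "('v, 'k::field) mpoly"
  assumes "finite F" "p \<notin> face_ideal (Pow F)" "q \<notin> face_ideal (Pow F)"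
  shows "p * q \<notin> face_ideal (Pow F)"
proof -
  obtain \<iota> :: "'v \<Rightarrow> nat" where \<iota>: "inj_on \<iota> F" using finite_imp_inj_to_nat_seg[OF assms(1)] by blast
  define enc where "enc m = (\<Sum>v\<in>F. Poly_Mapping.single (\<iota> v) (Poly_Mapping.lookup m v))" for m :: "'v \<Rightarrow>\<^sub>0 nat"
  have enc_add: "enc (a + b) = enc a + enc b" for a b
    by (simp add: enc_def lookup_add single_add sum.distrib)
  have enc_inj: "a = b" if "Poly_Mapping.keys a \<subseteq> F" "Poly_Mapping.keys b \<subseteq> F"
      "enc a = enc b" for a b
  proof (rule poly_mapping_eqI)
    fix v
    have lookup_enc: "Poly_Mapping.lookup (enc m) (\<iota> v) = Poly_Mapping.lookup m v" if "v \<in> F" for m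
    proof -
      have "Poly_Mapping.lookup (enc m) (\<iota> v) = (\<Sum>u\<in>F. if u =
          v then Poly_Mapping.lookup m u else 0)"
        unfolding enc_def lookup_sum lookup_single
        using \<iota> that by (intro sum.cong) (auto simp: when_def inj_on_def)
      then show ?thesis using that assms(1) by simp
    qed
    show "Poly_Mapping.lookup a v = Poly_Mapping.lookup b v"
    proof (cases "v \<in> F")
      case True
      then show ?thesis using that(3) lookup_enc by metis
    next
      case False
      then have "v \<notin> Poly_Mapping.keys a" "v \<notin> Poly_Mapping.keys b" using that by auto
      then show ?thesis by (simp add: in_keys_iff)
    qed
  qed
  have leading: "\<exists>m\<in>Poly_Mapping.keys r. Poly_Mapping.keys m \<subseteq> F \<and>
      (\<forall>n\<in>Poly_Mapping.keys r. Poly_Mapping.keys n \<subseteq> F \<longrightarrow> enc n \<le> enc m)"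
    if "r \<notin> face_ideal (Pow F)" for r :: "('v, 'k) mpoly"
  proof -
    let ?M = "{m \<in> Poly_Mapping.keys r. Poly_Mapping.keys m \<subseteq> F}"
    have "finite (enc ` ?M)" "enc ` ?M \<noteq> {}" using that by (auto simp: face_ideal_def)
    then have max: "Max (enc ` ?M) \<in> enc ` ?M" "\<And>n. n \<in> ?M \<Longrightarrow> enc n \<le> Max (enc ` ?M)"
      using Max_in[of "enc ` ?M"] Max_ge[of "enc ` ?M"] by blast+
    then obtain m where "m \<in> ?M" "Max (enc ` ?M) = enc m" by blast
    then show ?thesis using max(2) by (intro bexI[of _ m]) auto
  qed
  obtain m where m: "m \<in> Poly_Mapping.keys p" "Poly_Mapping.keys m \<subseteq> F"
      "\<And>n. n \<in> Poly_Mapping.keys p \<Longrightarrow> Poly_Mapping.keys n \<subseteq> F \<Longrightarrow> enc n \<le> enc m"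
    using leading[OF assms(2)] by blast
  obtain n where n: "n \<in> Poly_Mapping.keys q" "Poly_Mapping.keys n \<subseteq> F"
      "\<And>m. m \<in> Poly_Mapping.keys q \<Longrightarrow> Poly_Mapping.keys m \<subseteq> F \<Longrightarrow> enc m \<le> enc n"
    using leading[OF assms(3)] by blast
  have "Poly_Mapping.lookup (Poly_Mapping.single a (Poly_Mapping.lookup p a) * q) (m + n) =
      0" if a: "a \<in> Poly_Mapping.keys p - {m}" for a
  proof (rule ccontr)
    assume "Poly_Mapping.lookup (Poly_Mapping.single a (Poly_Mapping.lookup p a) * q) (m + n) \<noteq> 0"
    then have "m + n \<in> Poly_Mapping.keys (Poly_Mapping.single a (Poly_Mapping.lookup p a) * q)"
        by (simp add: in_keys_iff)
    then obtain b where b: "m + n = a + b" "b \<in> Poly_Mapping.keys q"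
      using keys_mult[of "Poly_Mapping.single a (Poly_Mapping.lookup p a)" q]
          by (auto split: if_splits)
    \<comment> \<open>Exponents cannot cancel, so both factors of a monomial supported in
      \<open>F\<close> are supported in \<open>F\<close>. Hence the maximality of \<open>m\<close>
      and \<open>n\<close> applies to \<open>a\<close> and \<open>b\<close>.\<close>
    have "Poly_Mapping.keys a \<union> Poly_Mapping.keys b \<subseteq> F"
        using m(2) n(2) b(1) by (metis keys_plus_nat Un_least)
    then have sub: "Poly_Mapping.keys a \<subseteq> F" "Poly_Mapping.keys b \<subseteq> F" by auto
    have le: "enc a \<le> enc m" "enc b \<le> enc n" using m(3) n(3) a b(2) sub by auto
    have eq: "enc a + enc b = enc m + enc n" using b(1) by (metis enc_add)
    have "enc a = enc m"
    proof (rule ccontr)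
      assume "enc a \<noteq> enc m"
      then have "enc a < enc m" using le(1) by simp
      then have "enc a + enc b < enc m + enc n" using le(2) by (rule add_less_le_mono)
      then show False using eq by simp
    qed
    then have "a = m" by (rule enc_inj[OF sub(1) m(2)])
    then show False using a by blast
  qed
  note other = this
  have "p * q = (\<Sum>a\<in>Poly_Mapping.keys p. Poly_Mapping.single a (Poly_Mapping.lookup p a) * q)"
    by (subst poly_mapping_sum_single[of p]) (simp add: sum_distrib_right)
  then have "Poly_Mapping.lookup (p * q) (m + n) =
      (\<Sum>a\<in>Poly_Mapping.keys p. Poly_Mapping.lookup (Poly_Mapping.single a (Poly_Mapping.lookup p a) * q) (m + n))"
    by (simp add: lookup_sum)
  also have "\<dots> = Poly_Mapping.lookup (Poly_Mapping.single m (Poly_Mapping.lookup p m) * q) (m + n)"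
    using m(1) other by (subst sum.remove[of _ m]) auto
  also have "\<dots> = Poly_Mapping.lookup p m * Poly_Mapping.lookup q n" by (rule lookup_single_mult)
  finally have "m + n \<in> Poly_Mapping.keys (p * q)" using m(1) n(1) by (simp add: in_keys_iff)
  then show ?thesis
    using m(2) n(2) by (auto simp: face_ideal_def keys_plus_nat intro!: bexI[of _ "m + n"])
qed

section \<open>Quotients of the polynomial ring\<close>

lemma polynomial_ring_simps [simp]:
  "monoid.mult (polynomial_ring k V) = (*)" "monoid.one (polynomial_ring k V) = 1"
  "ring.zero (polynomial_ring k V) = 0" "ring.add (polynomial_ring k V) = (+)"
  by (simp_all add: polynomial_ring_def)

lemma carrier_polynomial_ring:
  "p \<in> carrier (polynomial_ring k V) \<longleftrightarrow> (\<forall>m\<in>Poly_Mapping.keys p. Poly_Mapping.keys m \<subseteq> V)"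
  by (simp add: polynomial_ring_def)

lemma polynomial_ring_zero_one_closed:
  "0 \<in> carrier (polynomial_ring k V)" "1 \<in> carrier (polynomial_ring k V)"
  by (simp_all add: carrier_polynomial_ring)

lemma polynomial_ring_closed:
  assumes "p \<in> carrier (polynomial_ring k V)" "q \<in> carrier (polynomial_ring k V)"
  shows "p + q \<in> carrier (polynomial_ring k V)" "p * q \<in> carrier (polynomial_ring k V)"
    "- p \<in> carrier (polynomial_ring k V)"
proof -
  show "p + q \<in> carrier (polynomial_ring k V)"
    using assms keys_add[of p q] unfolding carrier_polynomial_ring by blast
  show "- p \<in> carrier (polynomial_ring k V)"
    using assms unfolding carrier_polynomial_ring keys_minus by blast
  show "p * q \<in> carrier (polynomial_ring k V)"
    unfolding carrier_polynomial_ring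
  proof
    fix m assume "m \<in> Poly_Mapping.keys (p * q)"
    then obtain s t where "m = s + t" "s \<in> Poly_Mapping.keys p"
        "t \<in> Poly_Mapping.keys q" using keys_mult[of p q] by auto
    then show "Poly_Mapping.keys m \<subseteq> V"
        using assms by (auto simp: carrier_polynomial_ring keys_plus_nat)
  qed
qed

lemma cring_polynomial_ring: "cring (polynomial_ring k V)"
proof (rule cringI)
  show "abelian_group (polynomial_ring k V)"
  proof (rule abelian_groupI, goal_cases)
    case (6 x)
    then show ?case by (intro bexI[of _ "- x"]) (auto intro: polynomial_ring_closed)
  qed (auto simp: polynomial_ring_closed add.assoc add.commute polynomial_ring_zero_one_closed)
  show "comm_monoid (polynomial_ring k V)"
    by (rule comm_monoidI)
      (auto simp: polynomial_ring_closed mult.assoc mult.commute polynomial_ring_zero_one_closed)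
qed (auto simp: distrib_right)

lemma a_inv_polynomial_ring:
  assumes "p \<in> carrier (polynomial_ring k V)"
  shows "\<ominus>\<^bsub>polynomial_ring k V\<^esub> p = - p"
proof -
  interpret cring "polynomial_ring k V" by (rule cring_polynomial_ring)
  show ?thesis using assms polynomial_ring_closed[OF assms assms] by (intro minus_equality) auto
qed

text \<open>Passage to HOL-Algebra: ideals are handled as \<open>ring_ideal\<close> on the whole
  type, free of carrier conditions, and cut down to the carrier of $k[V]$ afterwards.\<close>

lemma ideal_ring_ideal_carrier:
  assumes "ring_ideal J"
  shows "ideal (J \<inter> carrier (polynomial_ring k V)) (polynomial_ring k V)"
proof (rule idealI)
  interpret cring "polynomial_ring k V" by (rule cring_polynomial_ring)
  show "ring (polynomial_ring k V)" by (rule ring_axioms)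
  show "subgroup (J \<inter> carrier (polynomial_ring k V)) (add_monoid (polynomial_ring k V))"
  proof (rule add.subgroupI)
    show "J \<inter> carrier (polynomial_ring k V) \<noteq> {}"
      using ring_ideal_zero[OF assms] zero_closed by auto
    fix a assume a: "a \<in> J \<inter> carrier (polynomial_ring k V)"
    have "- a \<in> J" using ring_ideal_mult[OF assms, of a "-1"] a by simp
    then show "\<ominus>\<^bsub>polynomial_ring k V\<^esub> a \<in> J \<inter> carrier (polynomial_ring k V)"
      using a polynomial_ring_closed[of a k V a] by (simp add: a_inv_polynomial_ring)
  qed (auto intro: ring_ideal_add[OF assms] polynomial_ring_closed)
qed (auto intro: ring_ideal_mult[OF assms] ring_ideal_mult_right[OF assms] polynomial_ring_closed)

lemma ideal_polynomial_ring_memI: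
  assumes "ideal J (polynomial_ring k V)"
    and "\<And>m. m \<in> Poly_Mapping.keys p \<Longrightarrow> Poly_Mapping.single m (Poly_Mapping.lookup p m) \<in> J"
  shows "p \<in> J"
proof -
  interpret ideal J "polynomial_ring k V" by fact
  have "(\<Sum>m\<in>A. Poly_Mapping.single m (Poly_Mapping.lookup p m)) \<in> J"
      if "A \<subseteq> Poly_Mapping.keys p" for A
    using finite_subset[OF that finite_keys] that
  proof (induction A rule: finite_induct)
    case empty
    then show ?case using additive_subgroup.zero_closed[OF additive_subgroup_axioms] by simp
  next
    case (insert m A)
    then show ?case
      using additive_subgroup.a_closed[OF additive_subgroup_axioms, of "Poly_Mapping.single m (Poly_Mapping.lookup p m)"] assms(2)[of m]
      by simp
  qed
  from this[of "Poly_Mapping.keys p"] show ?thesis using poly_mapping_sum_single[of p] by simp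
qed

lemma single_remove_var:
  assumes "v \<in> Poly_Mapping.keys m"
  shows "m = Poly_Mapping.single v 1 + (m - Poly_Mapping.single v (1::nat))"
  using assms
  by (intro poly_mapping_eqI) (auto simp: in_keys_iff lookup_add lookup_minus lookup_single when_def)

lemma keys_minus_subset: "Poly_Mapping.keys (m - n :: 'a \<Rightarrow>\<^sub>0 nat) \<subseteq> Poly_Mapping.keys m"
  by (auto simp: in_keys_iff lookup_minus)

lemma single_closed: "Poly_Mapping.keys m \<subseteq> V \<Longrightarrow>
    Poly_Mapping.single m c \<in> carrier (polynomial_ring k V)"
  by (simp add: carrier_polynomial_ring)

lemma graded_maximal_ideal_eq:
  "graded_maximal_ideal k V = face_ideal {{}} \<inter> carrier (polynomial_ring k V)"
proof (rule subset_antisym)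
  interpret cring "polynomial_ring k V" by (rule cring_polynomial_ring)
  have "simplicial_complex {{}}" by (simp add: simplicial_complex_def)
  then have "ideal (face_ideal {{}} \<inter> carrier (polynomial_ring k V)) (polynomial_ring k V)"
    by (intro ideal_ring_ideal_carrier ring_ideal_face_ideal)
  then show "graded_maximal_ideal k V \<subseteq> face_ideal {{}} \<inter> carrier (polynomial_ring k V)"
    unfolding graded_maximal_ideal_def
    by (intro genideal_minimal) (auto simp: pvar_def face_ideal_def carrier_polynomial_ring
        simp del: keys_eq_empty)
  have sub: "pvar k ` V \<subseteq> carrier (polynomial_ring k V)"
    by (auto simp: pvar_def carrier_polynomial_ring)
  then interpret m: ideal "graded_maximal_ideal k V" "polynomial_ring k V"
    unfolding graded_maximal_ideal_def by (rule genideal_ideal)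
  show "face_ideal {{}} \<inter> carrier (polynomial_ring k V) \<subseteq> graded_maximal_ideal k V"
  proof
    fix p assume p: "p \<in> face_ideal {{}} \<inter> carrier (polynomial_ring k V)"
    show "p \<in> graded_maximal_ideal k V"
    proof (rule ideal_polynomial_ring_memI[OF m.ideal_axioms])
      fix m assume m: "m \<in> Poly_Mapping.keys p"
      then obtain v where v: "v \<in> Poly_Mapping.keys m"
        using p by (auto simp: face_ideal_def simp del: keys_eq_empty)
      have "v \<in> V" using m v p by (auto simp: carrier_polynomial_ring)
      then have "pvar k v \<in> graded_maximal_ideal k V"
        using genideal_self[OF sub] by (auto simp: graded_maximal_ideal_def)
      moreover have "Poly_Mapping.single (m - Poly_Mapping.single v 1) (Poly_Mapping.lookup p m)
          \<in> carrier (polynomial_ring k V)"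
        using keys_minus_subset[of m "Poly_Mapping.single v 1"] m p
        by (intro single_closed) (auto simp: carrier_polynomial_ring)
      ultimately have "pvar k v * Poly_Mapping.single (m - Poly_Mapping.single v 1) (Poly_Mapping.lookup p m)
          \<in> graded_maximal_ideal k V"
        using m.I_r_closed by simp
      then show "Poly_Mapping.single m (Poly_Mapping.lookup p m) \<in> graded_maximal_ideal k V"
        using single_remove_var[OF v] by (simp add: pvar_def mult_single)
    qed
  qed
qed

text \<open>A monomial with dependent support contains both ends of an edge, hence is divisible by
  that edge's generator; membership in an ideal can be tested term by term.\<close>

lemma edge_ideal_eq:
  assumes "\<And>u. \<not> u \<rightarrow>\<^bsub>G\<^esub> u" "\<And>u v. u \<rightarrow>\<^bsub>G\<^esub> v \<Longrightarrow> u \<in> verts G \<and> v \<in> verts G"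
  shows "edge_ideal k G =
    face_ideal (Collect (independent_set G)) \<inter> carrier (polynomial_ring k (verts G))"
    (is "_ = face_ideal ?C \<inter> carrier ?R")
proof (rule subset_antisym)
  interpret cring ?R by (rule cring_polynomial_ring)
  let ?E = "{pvar k u * pvar k v | u v. u \<rightarrow>\<^bsub>G\<^esub> v}"
  have C: "simplicial_complex ?C"
    by (auto simp: simplicial_complex_def intro: independent_set_mono)
  have gen: "Poly_Mapping.keys (pvar k u * pvar k v) =
      {Poly_Mapping.single u 1 + Poly_Mapping.single v 1}" for u v
    by (simp add: pvar_def mult_single)
  have supp: "Poly_Mapping.keys (Poly_Mapping.single u 1 + Poly_Mapping.single v (1::nat)) =
      {u, v}" for u v
    by (auto simp: keys_plus_nat)
  have "ideal (face_ideal ?C \<inter> carrier ?R) ?R"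
    by (rule ideal_ring_ideal_carrier[OF ring_ideal_face_ideal[OF C]])
  moreover have "?E \<subseteq> face_ideal ?C \<inter> carrier ?R"
  proof
    fix p assume "p \<in> ?E"
    then obtain u v where uv: "p = pvar k u * pvar k v" "u \<rightarrow>\<^bsub>G\<^esub> v" by blast
    then have "\<not> independent_set G {u, v}" by (auto simp: independent_set_def)
    then show "p \<in> face_ideal ?C \<inter> carrier ?R"
      using uv(1) assms(2)[OF uv(2)] unfolding face_ideal_def carrier_polynomial_ring
      by (simp add: gen supp[simplified] carrier_polynomial_ring)
  qed
  ultimately show "edge_ideal k G \<subseteq> face_ideal ?C \<inter> carrier ?R"
    unfolding edge_ideal_def by (rule genideal_minimal)
  have sub: "?E \<subseteq> carrier ?R"
    using \<open>?E \<subseteq> face_ideal ?C \<inter> carrier ?R\<close> by blast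
  then interpret I: ideal "edge_ideal k G" ?R
    unfolding edge_ideal_def by (rule genideal_ideal)
  show "face_ideal ?C \<inter> carrier ?R \<subseteq> edge_ideal k G"
  proof
    fix p assume p: "p \<in> face_ideal ?C \<inter> carrier ?R"
    show "p \<in> edge_ideal k G"
    proof (rule ideal_polynomial_ring_memI[OF I.ideal_axioms])
      fix m assume m: "m \<in> Poly_Mapping.keys p"
      then have "Poly_Mapping.keys m \<subseteq> verts G" "\<not> independent_set G (Poly_Mapping.keys m)"
        using p by (auto simp: face_ideal_def carrier_polynomial_ring)
      then obtain u v where uv: "u \<in> Poly_Mapping.keys m" "v \<in> Poly_Mapping.keys m" "u \<rightarrow>\<^bsub>G\<^esub> v"
        by (auto simp: independent_set_def)
      \<comment> \<open>Distinct ends are what allows both variables to be divided out, as each may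
        occur with exponent 1.\<close>
      then have "u \<noteq> v" using assms(1) by auto
      define n where "n = m - Poly_Mapping.single u 1 - Poly_Mapping.single v (1::nat)"
      have "v \<in> Poly_Mapping.keys (m - Poly_Mapping.single u 1)"
        using uv(2) \<open>u \<noteq> v\<close> by (simp add: in_keys_iff lookup_minus lookup_single)
      from single_remove_var[OF this]
      have v: "m - Poly_Mapping.single u 1 = Poly_Mapping.single v 1 + n"
        unfolding n_def .
      have "m = Poly_Mapping.single u 1 + (Poly_Mapping.single v 1 + n)"
        using single_remove_var[OF uv(1)] unfolding v .
      then have eq: "Poly_Mapping.single m (Poly_Mapping.lookup p m) =
          (pvar k u * pvar k v) * Poly_Mapping.single n (Poly_Mapping.lookup p m)"
        by (simp add: pvar_def mult_single add.assoc)
      have "Poly_Mapping.keys n \<subseteq> Poly_Mapping.keys m"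
        unfolding n_def by (rule order.trans[OF keys_minus_subset keys_minus_subset])
      then have "Poly_Mapping.single n (Poly_Mapping.lookup p m) \<in> carrier ?R"
        using \<open>Poly_Mapping.keys m \<subseteq> verts G\<close> by (intro single_closed) auto
      moreover have "pvar k u * pvar k v \<in> edge_ideal k G"
        unfolding edge_ideal_def using genideal_self[OF sub] uv(3) by blast
      ultimately show "Poly_Mapping.single m (Poly_Mapping.lookup p m) \<in> edge_ideal k G"
        unfolding eq using I.I_r_closed by simp
    qed
  qed
qed

section \<open>The quotient of $k[V]$ as a quotient of the full ring\<close>

abbreviation project :: "'v set \<Rightarrow> ('v, 'k::field) mpoly \<Rightarrow> ('v, 'k) mpoly" where
  "project V \<equiv> restrict_keys (\<lambda>m. Poly_Mapping.keys m \<subseteq> V)"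

lemma project_closed: "project V p \<in> carrier (polynomial_ring k V)"
  by (simp add: carrier_polynomial_ring keys_restrict_keys)

lemma project_id: "p \<in> carrier (polynomial_ring k V) \<Longrightarrow> project V p = p"
  by (intro restrict_keys_id) (simp add: carrier_polynomial_ring)

lemma diff_project: "p - project V p \<in> face_ideal (Pow V)"
  by (auto simp: face_ideal_def in_keys_iff lookup_minus lookup_restrict_keys)

text \<open>The additive monoids of the module and of \<open>R Quot I\<close> agree in their
  operations but differ in the type of their record extension, so facts about
  \<open>generate\<close> have to be carried across.\<close>

lemma generate_cong:
  fixes G :: "('a, 'b) monoid_scheme" and H :: "('a, 'c) monoid_scheme"
  assumes "carrier G = carrier H" "monoid.mult G = monoid.mult H" "monoid.one G = monoid.one H"
  shows "generate G A = generate H A"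
proof -
  have inv: "m_inv G = m_inv H" by (simp add: m_inv_def assms fun_eq_iff)
  have "x \<in> generate H A" if "x \<in> generate G A" for x
    using that by induction (auto simp: assms inv intro: generate.intros)
  moreover have "x \<in> generate G A" if "x \<in> generate H A" for x
    using that by induction (auto simp: assms[symmetric] inv[symmetric] intro: generate.intros)
  ultimately show ?thesis by blast
qed

text \<open>By \<open>outside\<close> all variables not in \<open>V\<close> lie in \<open>J\<close>.
  Hence the inclusion of $k[V]$ identifies its quotient by \<open>I\<close> with the full ring
  modulo \<open>J\<close>, and statements about the former can be read off from
  \<open>J\<close>.\<close>

locale polynomial_quotient =
  fixes k :: "'k::field itself" and V :: "'v set" and J :: "('v, 'k) mpoly set"
  assumes J: "ring_ideal J" and outside: "face_ideal (Pow V) \<subseteq> J"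
begin

abbreviation "R \<equiv> polynomial_ring k V"
abbreviation "I \<equiv> J \<inter> carrier R"
abbreviation "M \<equiv> quotient_module R I"

text \<open>Projecting first makes this total on the type: it is the surjection from the full ring
  onto the quotient, with kernel \<open>J\<close>.\<close>

definition proj :: "('v, 'k) mpoly \<Rightarrow> ('v, 'k) mpoly set" where
  "proj p = I +>\<^bsub>R\<^esub> project V p"

sublocale R: cring R
  by (rule cring_polynomial_ring)

sublocale I: ideal I R
  by (rule ideal_ring_ideal_carrier[OF J])

sublocale Q: cring "R Quot I"
  by (rule I.quotient_is_cring[OF R.cring_axioms])

lemma project_mem_iff:
  assumes "ring_ideal K" "J \<subseteq> K"
  shows "project V p \<in> K \<longleftrightarrow> p \<in> K"
proof -
  have "p - project V p \<in> K" using diff_project outside assms(2) by blast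
  from ring_ideal_add_iff[OF assms(1) this, of "project V p"] show ?thesis by simp
qed

lemma proj_carrier: "r \<in> carrier R \<Longrightarrow> proj r = I +>\<^bsub>R\<^esub> r"
  by (simp add: proj_def project_id)

lemma proj_eq_iff: "proj p = proj q \<longleftrightarrow> p - q \<in> J"
proof -
  have closed: "project V p \<in> carrier R" "project V q \<in> carrier R" by (rule project_closed)+
  have "proj p = proj q \<longleftrightarrow> project V p - project V q \<in> I"
    using R.quotient_eq_iff_same_a_r_cos[OF I.ideal_axioms closed] closed
    by (simp add: proj_def a_minus_def a_inv_polynomial_ring)
  also have "\<dots> \<longleftrightarrow> project V (p - q) \<in> J"
    using project_closed[of V "p - q" k] by (simp add: restrict_keys_diff)
  also have "\<dots> \<longleftrightarrow> p - q \<in> J" by (rule project_mem_iff[OF J subset_refl])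
  finally show ?thesis .
qed

lemma carrier_quotient: "carrier (R Quot I) = range proj"
proof -
  have "carrier (R Quot I) = (\<lambda>r. I +>\<^bsub>R\<^esub> r) ` carrier R"
    unfolding FactRing_def A_RCOSETS_def' by auto
  also have "\<dots> = range proj"
    using project_closed proj_carrier by (fastforce simp: proj_def image_iff)
  finally show ?thesis .
qed

lemma add_quotient: "proj p \<oplus>\<^bsub>R Quot I\<^esub> proj q = proj (p + q)"
  using I.a_rcos_sum[of "project V p" "project V q"] project_closed[of V _ k]
  by (simp add: FactRing_def proj_def restrict_keys_add)

lemma mult_quotient: "proj p \<otimes>\<^bsub>R Quot I\<^esub> proj q = proj (p * q)"
proof -
  have "proj p \<otimes>\<^bsub>R Quot I\<^esub> proj q = I +>\<^bsub>R\<^esub> (project V p * project V q)"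
    using I.rcoset_mult_add[of "project V p" "project V q"] project_closed[of V _ k]
    by (simp add: FactRing_def proj_def)
  also have "\<dots> = proj (project V p * project V q)"
    by (simp add: proj_carrier polynomial_ring_closed project_closed)
  also have "\<dots> = proj (p * q)"
    unfolding proj_eq_iff
  proof -
    have d: "p - project V p \<in> J" "q - project V q \<in> J" using diff_project outside by blast+
    have "- (q * (p - project V p)) - project V p * (q - project V q) \<in> J"
      using ring_ideal_diff[OF J ring_ideal_mult[OF J d(1), of "- q"] ring_ideal_mult[OF J d(2)]]
      by simp
    then show "project V p * project V q - p * q \<in> J" by (simp add: algebra_simps)
  qed
  finally show ?thesis .
qed

lemma zero_quotient: "\<zero>\<^bsub>R Quot I\<^esub> = proj 0"
  using R.a_rcos_zero[OF I.ideal_axioms, of 0] ring_ideal_zero[OF J]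
  by (simp add: FactRing_def proj_carrier polynomial_ring_zero_one_closed)

lemma one_quotient: "\<one>\<^bsub>R Quot I\<^esub> = proj 1"
  using R.one_closed by (simp add: FactRing_def proj_carrier)

lemma quotient_module_simps:
  "carrier M = range proj" "\<zero>\<^bsub>M\<^esub> = proj 0"
  "proj p \<oplus>\<^bsub>M\<^esub> proj q = proj (p + q)"
  using carrier_quotient zero_quotient add_quotient
  by (simp_all add: quotient_module_def ring.extend_def module.fields_def)

lemma set_smult_quotient:
  "set_smult K M =
    generate (add_monoid (R Quot I)) {a \<odot>\<^bsub>M\<^esub> x | a x. a \<in> K \<and> x \<in> carrier M}"
  unfolding set_smult_def
  by (rule generate_cong) (simp_all add: quotient_module_def ring.extend_def module.fields_def)

lemma smult_proj: "a \<in> carrier R \<Longrightarrow> a \<odot>\<^bsub>M\<^esub> proj p = proj (a * p)"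
  using mult_quotient[of a p]
  by (simp add: quotient_module_def ring.extend_def module.fields_def proj_carrier)

lemma proj_mem_image:
  assumes "ring_ideal K" "J \<subseteq> K"
  shows "proj p \<in> proj ` K \<longleftrightarrow> p \<in> K"
proof
  assume "proj p \<in> proj ` K"
  then obtain q where "q \<in> K" "p - q \<in> J" by (auto simp: proj_eq_iff)
  then show "p \<in> K" using ring_ideal_add_iff[OF assms(1), of "p - q" q] assms(2) by auto
qed simp

lemma ideal_image_proj:
  assumes "ring_ideal K" "J \<subseteq> K"
  shows "ideal (proj ` K) (R Quot I)"
proof -
  have "proj ` K = (\<lambda>r. I +>\<^bsub>R\<^esub> r) ` (K \<inter> carrier R)"
  proof (intro subset_antisym image_subsetI)
    fix p assume "p \<in> K"
    then have "project V p \<in> K \<inter> carrier R"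
      using project_mem_iff[OF assms] project_closed by blast
    then show "proj p \<in> (\<lambda>r. I +>\<^bsub>R\<^esub> r) ` (K \<inter> carrier R)" unfolding proj_def by (rule imageI)
  next
    fix r assume "r \<in> K \<inter> carrier R"
    then show "I +>\<^bsub>R\<^esub> r \<in> proj ` K" using proj_carrier by (metis IntD1 IntD2 imageI)
  qed
  then show ?thesis
    using R.ring_ideal_imp_quot_ideal[OF I.ideal_axioms ideal_ring_ideal_carrier[OF assms(1)]]
        by simp
qed

lemma set_smult_iff:
  assumes "set fs \<subseteq> carrier R"
  shows "proj p \<in> set_smult (genideal R (set fs)) M \<longleftrightarrow> p \<in> foldl adjoin J fs"
proof -
  let ?D = "foldl adjoin J fs"
  define H where "H = {a \<odot>\<^bsub>M\<^esub> x | a x. a \<in> genideal R (set fs) \<and> x \<in> carrier M}"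
  define S where "S = generate (add_monoid (R Quot I)) H"
  have S: "set_smult (genideal R (set fs)) M = S"
    by (simp add: set_smult_quotient S_def H_def)
  have D: "ring_ideal ?D" "J \<subseteq> ?D"
    using ring_ideal_foldl_adjoin[OF J] foldl_adjoin_base by auto
  have "set fs \<subseteq> ?D \<inter> carrier R"
    using foldl_adjoin_gen[OF J] assms by blast
  then have gen: "genideal R (set fs) \<subseteq> ?D \<inter> carrier R"
    by (intro R.genideal_minimal ideal_ring_ideal_carrier D)
  have "H \<subseteq> proj ` ?D"
  proof
    fix h assume "h \<in> H"
    then obtain a p where "h = a \<odot>\<^bsub>M\<^esub> proj p" "a \<in> genideal R (set fs)"
      by (auto simp: H_def quotient_module_simps)
    then have "h = proj (a * p)" "a * p \<in> ?D"
      using gen ring_ideal_mult_right[OF D(1)] smult_proj by blast+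
    then show "h \<in> proj ` ?D" by blast
  qed
  moreover have "subgroup (proj ` ?D) (add_monoid (R Quot I))"
    using ideal_image_proj[OF D] by (simp add: ideal_def additive_subgroup_def)
  ultimately have "S \<subseteq> proj ` ?D"
    unfolding S_def by (rule Q.add.generate_subgroup_incl)
  \<comment> \<open>\<open>generate\<close> yields only an additive subgroup. Quantifying over all
    multipliers \<open>c\<close> makes the set an ideal, so that it suffices to check
    \<open>J\<close> and the generators; \<open>c = 1\<close> gives the claim.\<close>
  moreover have "?D \<subseteq> {p. \<forall>c. proj (c * p) \<in> S}"
  proof (rule foldl_adjoin_least)
    show "ring_ideal {p. \<forall>c. proj (c * p) \<in> S}"
    proof (rule ring_idealI)
      show "0 \<in> {p. \<forall>c. proj (c * p) \<in> S}"
        using generate.one[of "add_monoid (R Quot I)" H] by (simp add: S_def zero_quotient)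
      fix a b assume "a \<in> {p. \<forall>c. proj (c * p) \<in> S}" "b \<in> {p. \<forall>c. proj (c * p) \<in> S}"
      then have "proj (c * a) \<oplus>\<^bsub>R Quot I\<^esub> proj (c * b) \<in> S" for c
        using generate.eng[of "proj (c * a)" "add_monoid (R Quot I)" H "proj (c * b)"]
        by (simp add: S_def)
      then show "a + b \<in> {p. \<forall>c. proj (c * p) \<in> S}"
        by (simp add: add_quotient distrib_left)
    next
      fix a r assume "a \<in> {p. \<forall>c. proj (c * p) \<in> S}"
      then show "r * a \<in> {p. \<forall>c. proj (c * p) \<in> S}" by (simp flip: mult.assoc)
    qed
    show "J \<subseteq> {p. \<forall>c. proj (c * p) \<in> S}"
    proof (intro subsetI CollectI allI)
      fix p c assume "p \<in> J"
      then have "proj (c * p) = proj 0" by (simp add: proj_eq_iff ring_ideal_mult[OF J])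
      then show "proj (c * p) \<in> S"
        using generate.one[of "add_monoid (R Quot I)" H] by (simp add: S_def zero_quotient)
    qed
    show "set fs \<subseteq> {p. \<forall>c. proj (c * p) \<in> S}"
    proof (intro subsetI CollectI allI)
      fix f c assume "f \<in> set fs"
      then have "f \<in> genideal R (set fs)" "f \<in> carrier R"
        using R.genideal_self[OF assms] assms by blast+
      then have "proj (c * f) \<in> H"
        unfolding H_def quotient_module_simps(1)
        by (auto intro!: exI[of _ f] exI[of _ "proj c"] simp: smult_proj mult.commute)
      then show "proj (c * f) \<in> S" unfolding S_def by (rule generate.incl)
    qed
  qed
  ultimately show ?thesis
    unfolding S using proj_mem_image[OF D, of p]
        by (metis (mono_tags, lifting) mem_Collect_eq mult_1 subsetD)
qed

lemma regular_sequence_iff: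
  assumes "set fs \<subseteq> carrier R"
  shows "regular_sequence R M fs \<longleftrightarrow> weakly_regular J fs \<and> 1 \<notin> foldl adjoin J fs"
proof -
  have nth: "(\<forall>x \<in> carrier M.
        fs ! i \<odot>\<^bsub>M\<^esub> x \<in> set_smult (genideal R (set (take i fs))) M \<longrightarrow>
        x \<in> set_smult (genideal R (set (take i fs))) M) \<longleftrightarrow>
      nonzerodivisor_mod (foldl adjoin J (take i fs)) (fs ! i)" if "i < length fs" for i
  proof -
    have "set (take i fs) \<subseteq> carrier R" using assms set_take_subset by fastforce
    moreover have "fs ! i \<in> carrier R" using assms that nth_mem by blast
    ultimately show ?thesis
      unfolding quotient_module_simps(1) nonzerodivisor_mod_def
      by (simp add: smult_proj set_smult_iff)
  qed
  let ?D = "foldl adjoin J fs"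
  have D: "ring_ideal ?D" by (rule ring_ideal_foldl_adjoin[OF J])
  have "set_smult (genideal R (set fs)) M \<subseteq> carrier M"
  proof -
    have "genideal R (set fs) \<subseteq> carrier R"
      using ideal.Icarr[OF R.genideal_ideal[OF assms]] by (rule subsetI)
    then have "{a \<odot>\<^bsub>M\<^esub> x | a x. a \<in> genideal R (set fs) \<and> x \<in> carrier M} \<subseteq> carrier (R Quot I)"
      unfolding carrier_quotient quotient_module_simps(1) by (auto simp: smult_proj)
    then show ?thesis
      unfolding set_smult_quotient
      using Q.add.generate_incl by (simp add: carrier_quotient quotient_module_simps(1))
  qed
  moreover have "carrier M \<subseteq> set_smult (genideal R (set fs)) M \<longleftrightarrow> ?D = UNIV"
    unfolding quotient_module_simps(1) by (auto simp: set_smult_iff[OF assms])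
  moreover have "?D = UNIV \<longleftrightarrow> 1 \<in> ?D"
    using ring_ideal_mult_right[OF D, of 1] by auto
  ultimately have "set_smult (genideal R (set fs)) M \<noteq> carrier M \<longleftrightarrow> 1 \<notin> ?D" by blast
  then show ?thesis
    unfolding regular_sequence_def weakly_regular_iff_nth using nth assms by blast
qed

lemma annihilator_eq: "annihilator R M = I"
proof (intro Set.set_eqI iffI)
  fix r assume "r \<in> annihilator R M"
  then have r: "r \<in> carrier R" "r \<odot>\<^bsub>M\<^esub> proj 1 = proj 0"
    by (auto simp: annihilator_def quotient_module_simps)
  then show "r \<in> I" by (simp add: smult_proj proj_eq_iff)
next
  fix r assume r: "r \<in> I"
  then show "r \<in> annihilator R M"
    by (auto simp: annihilator_def quotient_module_simps smult_proj proj_eq_iff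
        intro: ring_ideal_mult_right[OF J])
qed

lemma primeideal_image_proj:
  assumes "ring_ideal K" "J \<subseteq> K" "1 \<notin> K" "\<And>p q. p * q \<in> K \<Longrightarrow> p \<in> K \<or> q \<in> K"
  shows "primeideal (proj ` K) (R Quot I)"
proof (rule primeidealI[OF ideal_image_proj[OF assms(1,2)] Q.cring_axioms])
  show "carrier (R Quot I) \<noteq> proj ` K"
    using proj_mem_image[OF assms(1,2), of 1] assms(3) by (auto simp: carrier_quotient)
  fix a b assume "a \<in> carrier (R Quot I)" "b \<in> carrier (R Quot I)" "a \<otimes>\<^bsub>R Quot I\<^esub> b \<in> proj ` K"
  then obtain p q where "a = proj p" "b = proj q" "proj (p * q) \<in> proj ` K"
    by (auto simp: carrier_quotient mult_quotient)
  then show "a \<in> proj ` K \<or> b \<in> proj ` K"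
    using proj_mem_image[OF assms(1,2)] assms(4)[of p q] by simp
qed

lemma primeideal_vimage_proj:
  assumes "primeideal P (R Quot I)"
  shows "ring_ideal {p. proj p \<in> P}" "J \<subseteq> {p. proj p \<in> P}" "1 \<notin> {p. proj p \<in> P}"
    "p * q \<in> {p. proj p \<in> P} \<Longrightarrow> p \<in> {p. proj p \<in> P} \<or> q \<in> {p. proj p \<in> P}"
proof -
  interpret P: primeideal P "R Quot I" by fact
  have zero: "proj 0 \<in> P" using additive_subgroup.zero_closed[OF P.additive_subgroup_axioms]
    by (simp add: zero_quotient)
  show "ring_ideal {p. proj p \<in> P}"
  proof (rule ring_idealI)
    fix a b assume "a \<in> {p. proj p \<in> P}" "b \<in> {p. proj p \<in> P}"
    then show "a + b \<in> {p. proj p \<in> P}"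
        using additive_subgroup.a_closed[OF P.additive_subgroup_axioms, of "proj a" "proj b"]
      by (simp add: add_quotient)
  next
    fix a r assume "a \<in> {p. proj p \<in> P}"
    then show "r * a \<in> {p. proj p \<in> P}"
      using P.I_l_closed[of "proj a" "proj r"] by (simp add: mult_quotient carrier_quotient)
  qed (simp add: zero)
  show "J \<subseteq> {p. proj p \<in> P}"
  proof
    fix p assume "p \<in> J"
    then have "proj p = proj 0" by (simp add: proj_eq_iff)
    then show "p \<in> {p. proj p \<in> P}" using zero by simp
  qed
  show "1 \<notin> {p. proj p \<in> P}"
    using P.one_imp_carrier P.I_notcarr by (auto simp: one_quotient)
  show "p * q \<in> {p. proj p \<in> P} \<Longrightarrow> p \<in> {p. proj p \<in> P} \<or> q \<in> {p. proj p \<in> P}"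
    using P.I_prime[of "proj p" "proj q"] by (simp add: mult_quotient carrier_quotient)
qed

end

section \<open>Depth and dimension of face rings\<close>

lemma ideal_chainI:
  assumes "\<And>i. i \<le> d \<Longrightarrow> ring_ideal (K i)" "\<And>i. i < d \<Longrightarrow> nonzerodivisor_mod (K i) (g i)"
    "\<And>i. i < d \<Longrightarrow> adjoin (K i) (g i) \<subseteq> K (Suc i)"
  shows "ideal_chain (K 0) (map g [0..<d]) (K d)"
  using assms
proof (induction d arbitrary: K g)
  case 0
  then show ?case by (simp add: ideal_chain.Nil)
next
  case (Suc d)
  have "ideal_chain (K (Suc 0)) (map (\<lambda>i. g (Suc i)) [0..<d]) (K (Suc d))"
    using Suc.IH[of "\<lambda>i. K (Suc i)" "\<lambda>i. g (Suc i)"] Suc.prems by simp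
  moreover have "map g [0..<Suc d] = g 0 # map (\<lambda>i. g (Suc i)) [0..<d]"
    by (simp add: upt_conv_Cons flip: map_Suc_upt del: upt_Suc)
  ultimately show ?case
    using ideal_chain.Cons[of "K 0" "g 0" "K (Suc 0)"] Suc.prems by (simp del: upt_Suc)
qed

lemma face_ideal_antimono: "C \<subseteq> D \<Longrightarrow> face_ideal D \<subseteq> face_ideal C"
  by (auto simp: face_ideal_def)

text \<open>The prime of \<open>F\<close> is generated by the variables outside \<open>F\<close>:
  each of its terms contains one of them.\<close>

lemma face_ideal_memI:
  fixes p :: "('v, 'k::field) mpoly"
  assumes "ring_ideal K" "p \<in> face_ideal (Pow F)" "\<And>v. v \<notin> F \<Longrightarrow> var v \<in> K"
  shows "p \<in> K"
proof -
  have "Poly_Mapping.single m (Poly_Mapping.lookup p m) \<in> K" if m: "m \<in> Poly_Mapping.keys p" for m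
  proof -
    obtain v where v: "v \<in> Poly_Mapping.keys m"
        "v \<notin> F" using assms(2) m by (auto simp: face_ideal_def)
    have "Poly_Mapping.single m (Poly_Mapping.lookup p m) =
        var v * Poly_Mapping.single (m - Poly_Mapping.single v 1) (Poly_Mapping.lookup p m)"
      using single_remove_var[OF v(1)] by (simp add: mult_single)
    then show ?thesis using ring_ideal_mult_right[OF assms(1) assms(3)[OF v(2)]] by simp
  qed
  then have "(\<Sum>m\<in>Poly_Mapping.keys p. Poly_Mapping.single m (Poly_Mapping.lookup p m)) \<in> K"
    by (rule ring_ideal_sum[OF assms(1)])
  then show ?thesis using poly_mapping_sum_single[of p] by simp
qed

context
  fixes k :: "'k::field itself" and V :: "'v set" and C :: "'v set set"
  assumes V: "finite V" and C: "simplicial_complex C" "C \<subseteq> Pow V"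
begin

interpretation polynomial_quotient k V "face_ideal C :: ('v, 'k) mpoly set"
  by unfold_locales (rule ring_ideal_face_ideal[OF C(1)], rule face_ideal_antimono[OF C(2)])

text \<open>The variables of \<open>F\<close> are put into the ideal one after another. The primes
  of the faces \<open>set (drop i xs)\<close> grow strictly from the prime of \<open>F\<close> to
  that of the empty face.\<close>

lemma prime_chain_of_face:
  assumes "F \<in> C"
  shows "\<exists>P :: nat \<Rightarrow> ('v, 'k) mpoly set set.
    (\<forall>i\<le>card F. primeideal (P i) (R Quot I)) \<and> (\<forall>i<card F. P i \<subset> P (Suc i))"
proof -
  have "F \<subseteq> V" using assms C(2) by blast
  then have "finite F" by (rule finite_subset[OF _ V])
  then obtain xs where xs: "set xs = F" "distinct xs" using finite_distinct_list by blast
  then have len: "length xs = card F" using distinct_card by fastforce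
  define K :: "nat \<Rightarrow> ('v, 'k) mpoly set" where "K i = face_ideal (Pow (set (drop i xs)))" for i
  have K: "ring_ideal (K i)" "face_ideal C \<subseteq> K i" for i
  proof -
    show "ring_ideal (K i)" unfolding K_def
        by (rule ring_ideal_face_ideal[OF simplicial_complex_Pow])
    have "Pow (set (drop i xs)) \<subseteq> C"
      using C(1) assms xs(1) set_drop_subset[of i xs] unfolding simplicial_complex_def by blast
    then show "face_ideal C \<subseteq> K i" unfolding K_def by (rule face_ideal_antimono)
  qed
  have "primeideal (proj ` K i) (R Quot I)" for i
  proof (rule primeideal_image_proj[OF K])
    show "1 \<notin> K i" by (simp add: K_def face_ideal_def)
    show "p \<in> K i \<or> q \<in> K i" if "p * q \<in> K i" for p q
      using face_ideal_Pow_prime[of "set (drop i xs)" p q] that unfolding K_def by auto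
  qed
  moreover have "proj ` K i \<subset> proj ` K (Suc i)" if "i < card F" for i
  proof -
    have drop: "drop i xs = xs ! i # drop (Suc i) xs"
      using that len by (simp add: Cons_nth_drop_Suc)
    have "distinct (drop i xs)" using xs(2) by simp
    then have notin: "xs ! i \<notin> set (drop (Suc i) xs)" using drop by simp
    have "K i \<subseteq> K (Suc i)" unfolding K_def drop by (rule face_ideal_antimono) auto
    moreover have "var (xs ! i) \<in> K (Suc i)" using notin by (simp add: K_def face_ideal_def)
    moreover have "var (xs ! i) \<notin> K i" unfolding K_def drop by (simp add: face_ideal_def)
    then have "proj (var (xs ! i)) \<notin> proj ` K i" using proj_mem_image[OF K] by blast
    ultimately show ?thesis by blast
  qed
  ultimately show ?thesis by (intro exI[of _ "\<lambda>i. proj ` K i"]) blast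
qed

text \<open>An element of the next prime outside the current one is a nonzerodivisor modulo the
  current one, so pulled back to the full ring the primes form an \<open>ideal_chain\<close>, and
  counting applies with 1 as the element outside the top prime.\<close>

lemma prime_chain_length_le:
  fixes P :: "nat \<Rightarrow> ('v, 'k) mpoly set set"
  assumes prime: "\<And>i. i \<le> d \<Longrightarrow> primeideal (P i) (R Quot I)" and chain: "\<And>i. i < d \<Longrightarrow> P i \<subset> P (Suc i)"
  shows "\<exists>F\<in>C. d \<le> card F"
proof -
  define K where "K i = {p. proj p \<in> P i}" for i
  have K: "ring_ideal (K i)" "face_ideal C \<subseteq> K i" "1 \<notin> K i"
    and K_prime: "p * q \<in> K i \<Longrightarrow> p \<in> K i \<or> q \<in> K i" if "i \<le> d" for i p q
    unfolding K_def using primeideal_vimage_proj[OF prime[OF that]] by blast+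
  have "\<exists>g. g \<in> K (Suc i) \<and> g \<notin> K i" if "i < d" for i
  proof -
    obtain X where X: "X \<in> P (Suc i)" "X \<notin> P i" using chain[OF \<open>i < d\<close>] by blast
    interpret P: primeideal "P (Suc i)" "R Quot I" by (rule prime) (use that in simp)
    have "X \<in> range proj" using X(1) P.Icarr carrier_quotient by blast
    then show ?thesis using X by (auto simp: K_def)
  qed
  then obtain g where g: "\<And>i. i < d \<Longrightarrow> g i \<in> K (Suc i) \<and> g i \<notin> K i" by metis
  have K_mono: "K i \<subseteq> K (Suc i)" if "i < d" for i
    using chain[OF that] by (auto simp: K_def)
  have "ideal_chain (K 0) (map g [0..<d]) (K d)"
  proof (rule ideal_chainI)
    show "ring_ideal (K i)" if "i \<le> d" for i by (rule K(1)[OF that])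
    show "nonzerodivisor_mod (K i) (g i)" if "i < d" for i
      unfolding nonzerodivisor_mod_def using K_prime[of i "g i"] g[OF that] that by auto
    show "adjoin (K i) (g i) \<subseteq> K (Suc i)" if "i < d" for i
      by (rule adjoin_least) (use K(1)[of "Suc i"] K_mono[OF that] g[OF that] that in auto)
  qed
  \<comment> \<open>The variables avoiding the bottom prime. By primality their product avoids it
    too, and since that prime contains the face ideal, \<open>F\<close> must be a face. All other
    variables lie in \<open>K 0\<close>, hence so does the prime of \<open>F\<close>.\<close>
  moreover define F where "F = {v. (var v :: ('v, 'k) mpoly) \<notin> K 0}"
  have "F \<subseteq> V"
  proof
    fix v assume "v \<in> F"
    show "v \<in> V"
    proof (rule ccontr)
      assume "v \<notin> V"
      then have "var v \<in> face_ideal C" using C(2) by (auto simp: face_ideal_def)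
      then show False using K(2)[of 0] \<open>v \<in> F\<close> by (auto simp: F_def)
    qed
  qed
  then have "finite F" using V finite_subset by blast
  moreover have "F \<in> C"
  proof (rule ccontr)
    assume "F \<notin> C"
    have "(\<Prod>v\<in>A. var v :: ('v, 'k) mpoly) \<notin> K 0" if "A \<subseteq> F" for A
      using finite_subset[OF that \<open>finite F\<close>] that
    proof (induction A rule: finite_induct)
      case empty
      then show ?case using K(3)[of 0] by simp
    next
      case (insert v A)
      then show ?case using K_prime[of 0 "var v" "\<Prod>v\<in>A. var v"] by (auto simp: F_def)
    qed
    from this[of F] have "Poly_Mapping.single (squarefree_monomial F) (1::'k) \<notin> K 0"
      unfolding prod_var[OF \<open>finite F\<close>] by simp
    moreover have "Poly_Mapping.single (squarefree_monomial F) (1::'k) \<in> face_ideal C"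
      using \<open>F \<notin> C\<close> \<open>finite F\<close> by (simp add: face_ideal_def keys_squarefree_monomial)
    ultimately show False using K(2)[of 0] by blast
  qed
  moreover have "p * 1 \<in> K 0" if "p \<in> face_ideal (Pow F)" for p
    using face_ideal_memI[OF K(1)[of 0] that] by (simp add: F_def)
  ultimately have "length (map g [0..<d]) \<le> card F"
    using K(3)[of d] by (intro ideal_chain_length_le) auto
  then show ?thesis using \<open>F \<in> C\<close> by auto
qed

lemma module_dim_face_ideal:
  assumes "{} \<in> C"
  shows "module_dim R M = enat (Max (card ` C))"
proof -
  have fin: "finite (card ` C)" using C(2) V by (meson finite_Pow_iff finite_imageI finite_subset)
  have "Max (card ` C) \<in> card ` C" using fin assms by (intro Max_in) auto
  then obtain F where F: "F \<in> C" "Max (card ` C) = card F" by blast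
  have "Sup {enat d | d. \<exists>P :: nat \<Rightarrow> ('v, 'k) mpoly set set.
     (\<forall>i \<le> d. primeideal (P i) (R Quot I)) \<and> (\<forall>i < d. P i \<subset> P (Suc i))} = enat (Max (card ` C))"
    (is "Sup ?S = _")
  proof (rule antisym)
    show "Sup ?S \<le> enat (Max (card ` C))"
    proof (rule Sup_least)
      fix e assume "e \<in> ?S"
      then obtain d and P :: "nat \<Rightarrow> ('v, 'k) mpoly set set" where e: "e = enat d"
        and "\<forall>i \<le> d. primeideal (P i) (R Quot I)" "\<forall>i < d. P i \<subset> P (Suc i)" by blast
      then obtain F where "F \<in> C" "d \<le> card F" using prime_chain_length_le[of d P] by blast
      moreover have "card F \<le> Max (card ` C)" using fin \<open>F \<in> C\<close> by (intro Max_ge) auto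
      ultimately show "e \<le> enat (Max (card ` C))" using e by simp
    qed
    show "enat (Max (card ` C)) \<le> Sup ?S"
      by (rule Sup_upper) (use prime_chain_of_face[OF F(1)] F(2) in auto)
  qed
  then show ?thesis unfolding module_dim_def krull_dim_def annihilator_eq .
qed

lemma depth_le_facet:
  assumes "F \<in> C" "\<And>T. T \<in> C \<Longrightarrow> F \<subseteq> T \<Longrightarrow> T = F"
  shows "depth R (graded_maximal_ideal k V) M \<le> enat (card F)"
  unfolding depth_def
proof (rule Sup_least)
  fix e assume "e \<in> {enat (length fs) | fs. set fs \<subseteq> graded_maximal_ideal k V \<and>
      regular_sequence R M fs}"
  then obtain fs where fs: "e = enat (length fs)" "set fs \<subseteq> graded_maximal_ideal k V"
    "regular_sequence R M fs" by blast
  have "set fs \<subseteq> carrier R" using fs(2) by (auto simp: graded_maximal_ideal_eq)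
  then have "weakly_regular (face_ideal C) fs" using fs(3) regular_sequence_iff by blast
  moreover have "0 \<notin> Poly_Mapping.keys f" if "f \<in> set fs" for f
  proof
    assume "0 \<in> Poly_Mapping.keys f"
    moreover have "f \<in> face_ideal {{}}" using that fs(2) by (auto simp: graded_maximal_ideal_eq)
    ultimately have "Poly_Mapping.keys (0 :: 'v \<Rightarrow>\<^sub>0 nat) \<noteq> {}" unfolding face_ideal_def by blast
    then show False by simp
  qed
  moreover have "F \<subseteq> V" using assms(1) C(2) by blast
  then have "finite F" by (rule finite_subset[OF _ V])
  ultimately show "e \<le> enat (card F)"
    using weakly_regular_length_le_facet[OF C(1) assms, of fs] fs(1) by simp
qed

lemma depth_ge_elementary_symmetrics:
  assumes "{} \<in> C"
    and "weakly_regular (face_ideal C) (elementary_symmetrics V t :: ('v, 'k) mpoly list)"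
  shows "enat t \<le> depth R (graded_maximal_ideal k V) M"
  unfolding depth_def
proof (rule Sup_upper)
  let ?es = "elementary_symmetrics V t :: ('v, 'k) mpoly list"
  have es: "e \<in> face_ideal {{}} \<inter> carrier R" if e_in: "e \<in> set ?es" for e
  proof -
    obtain i where e: "e = elementary_symmetric V (Suc i)"
      using e_in by (auto simp: elementary_symmetrics_def)
    have "Poly_Mapping.keys m \<noteq> {} \<and> Poly_Mapping.keys m \<subseteq> V" if m: "m \<in> Poly_Mapping.keys e" for m
    proof -
      obtain S where S: "S \<subseteq> V" "card S = Suc i" "m = squarefree_monomial S"
        using keys_elementary_symmetric[OF V m[unfolded e]] by blast
      then have "finite S" "S \<noteq> {}" using V finite_subset by auto
      then show ?thesis using S by (simp add: keys_squarefree_monomial)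
    qed
    then show ?thesis by (auto simp: face_ideal_def carrier_polynomial_ring simp del: keys_eq_empty)
  qed
  \<comment> \<open>Properness: the face ideal and all members of the sequence lie among the
    polynomials without constant term.\<close>
  have "ring_ideal (face_ideal {{}} :: ('v, 'k) mpoly set)"
    by (rule ring_ideal_face_ideal) (simp add: simplicial_complex_def)
  moreover have "face_ideal C \<subseteq> (face_ideal {{}} :: ('v, 'k) mpoly set)"
    by (rule face_ideal_antimono) (use assms(1) in simp)
  ultimately have "foldl adjoin (face_ideal C) ?es \<subseteq> face_ideal {{}}"
    using es by (intro foldl_adjoin_least) auto
  moreover have "(1 :: ('v, 'k) mpoly) \<notin> face_ideal {{}}" by (simp add: face_ideal_def)
  ultimately have "regular_sequence R M ?es"
    using assms(2) es by (subst regular_sequence_iff) auto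
  moreover have "set ?es \<subseteq> graded_maximal_ideal k V"
      using es by (auto simp: graded_maximal_ideal_eq)
  moreover have "length ?es = t" by (simp add: elementary_symmetrics_def)
  ultimately show "enat t \<in> {enat (length fs) | fs.
      set fs \<subseteq> graded_maximal_ideal k V \<and> regular_sequence R M fs}"
    by (intro CollectI exI[of _ ?es]) simp
qed

end

theorem corollary2p12:
  fixes k :: "'k::field itself" and G :: "('v, 'e) pre_digraph"
  assumes "graph G" and "C5_free G" and "vertex_decomposable G"
  shows "depth (polynomial_ring k (verts G)) (graded_maximal_ideal k (verts G)) (edge_quotient k G) =
           enat (Min {card F | F. maximal_independent_set G F}) \<and>
         (cohen_macaulay (polynomial_ring k (verts G)) (graded_maximal_ideal k (verts G)) (edge_quotient k G)
           \<longleftrightarrow> unmixed G)"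
proof -
  interpret graph G by fact
  let ?C = "Collect (independent_set G)"
  have sym: "v \<rightarrow>\<^bsub>G\<^esub> u" if "u \<rightarrow>\<^bsub>G\<^esub> v" for u v
    by (rule arcs_ends_symmetric[OF sym_arcs that])
  have irrefl: "\<not> u \<rightarrow>\<^bsub>G\<^esub> u" for u
    using no_loops by (auto simp: arcs_ends_conv)
  have C: "simplicial_complex ?C" "?C \<subseteq> Pow (verts G)" "{} \<in> ?C"
    by (auto simp: simplicial_complex_def independent_set_def)
  have cone: "independence_cone G {} = ?C"
    by (auto simp: independence_cone_def independent_set_def Int_absorb2)
  have quotient: "edge_quotient k G = quotient_module (polynomial_ring k (verts G))
      (face_ideal ?C \<inter> carrier (polynomial_ring k (verts G)))"
    unfolding edge_quotient_def using edge_ideal_eq[of G k] irrefl adj_in_verts by auto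
  let ?cards = "{card F | F. maximal_independent_set G F}"
  have cards_sub: "?cards \<subseteq> card ` ?C" by (auto simp: maximal_independent_set_def)
  have fin: "finite (card ` ?C)"
    using C(2) finite_verts by (meson finite_Pow_iff finite_imageI finite_subset)
  have fin_cards: "finite ?cards" by (rule finite_subset[OF cards_sub fin])
  have ne: "?cards \<noteq> {}"
    using maximal_independent_superset[OF finite_verts, of "{}"] C(3) by auto
  \<comment> \<open>The dimension is a maximum over all faces; every independent set extends to a
    maximal one, so facets suffice.\<close>
  have Max_cards: "Max (card ` ?C) = Max ?cards"
  proof (rule antisym)
    show "Max ?cards \<le> Max (card ` ?C)" by (rule Max_mono[OF cards_sub ne fin])
    have "c \<le> Max ?cards" if c: "c \<in> card ` ?C" for c
    proof -
      obtain S where S: "independent_set G S" "c = card S" using c by blast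
      then obtain F where F: "maximal_independent_set G F" "S \<subseteq> F"
        using maximal_independent_superset[OF finite_verts] by blast
      have "F \<subseteq> verts G"
        using F(1) by (simp add: maximal_independent_set_def independent_set_def)
      then have "finite F" by (rule finite_subset) (rule finite_verts)
      then have "c \<le> card F" using F(2) S(2) by (simp add: card_mono)
      also have "\<dots> \<le> Max ?cards" by (rule Max_ge[OF fin_cards]) (use F(1) in blast)
      finally show ?thesis .
    qed
    then show "Max (card ` ?C) \<le> Max ?cards" using fin C(3) by (subst Max_le_iff) auto
  qed
  have depth: "depth (polynomial_ring k (verts G)) (graded_maximal_ideal k (verts G)) (edge_quotient k G)
      = enat (Min ?cards)"
    unfolding quotient
  proof (rule antisym)
    have "Min ?cards \<in> ?cards" by (rule Min_in[OF fin_cards ne])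
    then obtain F where F: "maximal_independent_set G F" "Min ?cards = card F" by blast
    show "depth (polynomial_ring k (verts G)) (graded_maximal_ideal k (verts G))
        (quotient_module (polynomial_ring k (verts G))
          (face_ideal ?C \<inter> carrier (polynomial_ring k (verts G)))) \<le> enat (Min ?cards)"
      unfolding F(2)
      by (rule depth_le_facet[OF finite_verts C(1,2)])
        (use F(1) in \<open>auto simp: maximal_independent_set_def\<close>)
    \<comment> \<open>At the start nothing has been coned off, so \<open>U\<close> is empty and
      \<open>t\<close> may be the least facet size.\<close>
    have "weakly_regular (face_ideal (independence_cone G {}))
        (elementary_symmetrics (verts G) (Min ?cards) :: ('v, 'k) mpoly list)"
    proof (rule weakly_regular_vertex_decomposable[OF assms(3)])
      show "Min ?cards \<le> card F + card {}" if "maximal_independent_set G F" for F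
        using Min_le[OF fin_cards, of "card F"] that by auto
    qed (use sym irrefl finite_verts in auto)
    then show "enat (Min ?cards) \<le> depth (polynomial_ring k (verts G)) (graded_maximal_ideal k (verts G))
        (quotient_module (polynomial_ring k (verts G))
          (face_ideal ?C \<inter> carrier (polynomial_ring k (verts G))))"
      unfolding cone by (rule depth_ge_elementary_symmetrics[OF finite_verts C])
  qed
  have dim: "module_dim (polynomial_ring k (verts G)) (edge_quotient k G) = enat (Max ?cards)"
    unfolding quotient using module_dim_face_ideal[OF finite_verts C, of k] Max_cards by simp
  \<comment> \<open>Depth is the least and dimension the greatest facet size, so their equality says
    that all facets have the same size.\<close>
  have "Min ?cards = Max ?cards \<longleftrightarrow> unmixed G"
  proof
    assume eq: "Min ?cards = Max ?cards"
    have "card F = Max ?cards" if "maximal_independent_set G F" for F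
    proof (rule antisym)
      have mem: "card F \<in> ?cards" using that by blast
      show "card F \<le> Max ?cards" by (rule Max_ge[OF fin_cards mem])
      show "Max ?cards \<le> card F" using Min_le[OF fin_cards mem] unfolding eq .
    qed
    then show "unmixed G" by (auto simp: unmixed_def)
  next
    assume "unmixed G"
    moreover obtain S T where "maximal_independent_set G S" "Min ?cards = card S"
        "maximal_independent_set G T" "Max ?cards = card T"
      using Min_in[OF fin_cards ne] Max_in[OF fin_cards ne] unfolding mem_Collect_eq by metis
    ultimately show "Min ?cards = Max ?cards" unfolding unmixed_def by metis
  qed
  then show ?thesis using depth dim by (simp add: cohen_macaulay_def)
qed

end
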